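(* Let $\mathcal{C}$ be an extriangulated category with a negative first extension. Let $[t_1,t_2]$ be an interval in the poset of $s$-torsion pairs in $\mathcal{C}$ and $\mathcal{H}_{[t_1,t_2]}$ its heart. Then there exists a poset isomorphism between $[t_1,t_2]$ and the poset of $s$-torsion pairs in $\mathcal{H}_{[t_1,t_2]}$.
   Context: All categories are skeletally small; all subcategories are full and closed under isomorphisms. **Extriangulated category** (Nakaoka–Palu). Let $\mathcal{C}$ be an additive category and $\mathbb{E}:\mathcal{C}^{\mathrm{op}}\times\mathcal{C}\to\mathcal{A}b$ an additive bifunctor to abelian groups (ET1). For $\delta\in\mathbb{E}(C,A)$, $a:A\to A'$, $c:C'\to C$ write $a_*\delta=\mathbb{E}(C,a)(\delta)$, $c^*\delta=\mathbb{E}(c,A)(\delta)$. A morphism from $\delta\in\mathbb{E}(C,A)$ to $\delta'\in\mathbb{E}(C',A')$ is a pair $(a:A\to A',c:C\to C')$ with $a_*\delta=c^*\delta'$. Two sequences $A\to B\to C$ and $A\to B'\to C$ are equivalent if there is an isomorphism $B\to B'$ compatible with $\mathrm{id}_A$ and $\mathrm{id}_C$; $[A\to B\to C]$ is the equivalence class. A realization $\mathfrak{s}$ assigns to each $\delta\in\mathbb{E}(C,A)$ a class $\mathfrak{s}(\delta)=[A\xrightarrow{x}B\xrightarrow{y}C]$ such that for each morphism $(a,c):\delta\to\delta'$ with $\mathfrak{s}(\delta')=[A'\xrightarrow{x'}B'\xrightarrow{y'}C']$ there is $b:B\to B'$ with $bx=x'a$, $y'b=cy$. (ET2): $\mathfrak{s}$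 is an additive realization, i.e. $\mathfrak{s}(0)=[A\to A\oplus C\to C]$ (split sequence) and $\mathfrak{s}(\delta\oplus\delta')=\mathfrak{s}(\delta)\oplus\mathfrak{s}(\delta')$. (ET3): if $\mathfrak{s}(\delta)=[A\xrightarrow{x}B\xrightarrow{y}C]$, $\mathfrak{s}(\delta')=[A'\xrightarrow{x'}B'\xrightarrow{y'}C']$ and $bx=x'a$, then there is $c:C\to C'$ with $cy=y'b$ and $a_*\delta=c^*\delta'$. (ET4): if $\delta\in\mathbb{E}(D,A)$, $\delta'\in\mathbb{E}(F,B)$ are realized by $A\xrightarrow{f}B\xrightarrow{f'}D$ and $B\xrightarrow{g}C\xrightarrow{g'}F$, then there are an object $E$, morphisms $h':C\to E$, $d:D\to E$, $e:E\to F$ with $df'=h'g$, $eh'=g'$, and $\delta''\in\mathbb{E}(E,A)$ realized by $A\xrightarrow{gf}C\xrightarrow{h'}E$, such that $D\xrightarrow{d}E\xrightarrow{e}F$ realizes $f'_*\delta'$, $d^*\delta''=\delta$ and $f_*\delta''=e^*\delta'$. (ET3)$^{\mathrm{op}}$, (ET4)$^{\mathrm{op}}$: the duals (the same axioms for the opposite category with reversed sequences). Then $(\mathcal{C},\mathbb{E},\mathfrak{s})$ is an extriangulated category. An $\mathfrak{s}$-conflation $A\xrightarrow{f}B\xrightarrow{g}C\overset{\delta}{\dashrightarrow}$ is a sequence with $\mathfrak{s}(\delta)=[A\xrightarrow{f}B\xrightarrow{g}C]$, $\delta\in\mathbb{E}(C,A)$. **Negative first extension.** A negative first extension structure on $(\mathcal{C},\mathbb{E},\mathfrak{s})$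 consists of (NE1) an additive bifunctor $\mathbb{E}^{-1}:\mathcal{C}^{\mathrm{op}}\times\mathcal{C}\to\mathcal{A}b$, and (NE2) for each $\delta\in\mathbb{E}(C,A)$, natural transformations $\delta^{-1}_\sharp:\mathbb{E}^{-1}(-,C)\to\mathcal{C}(-,A)$ and $\delta_{-1}^\sharp:\mathbb{E}^{-1}(A,-)\to\mathcal{C}(C,-)$ such that for each $\mathfrak{s}$-conflation $A\xrightarrow{f}B\xrightarrow{g}C\overset{\delta}{\dashrightarrow}$ and each $W\in\mathcal{C}$ the sequences $\mathbb{E}^{-1}(W,A)\to\mathbb{E}^{-1}(W,B)\to\mathbb{E}^{-1}(W,C)\xrightarrow{(\delta^{-1}_\sharp)_W}\mathcal{C}(W,A)\to\mathcal{C}(W,B)$ and $\mathbb{E}^{-1}(C,W)\to\mathbb{E}^{-1}(B,W)\to\mathbb{E}^{-1}(A,W)\xrightarrow{(\delta_{-1}^\sharp)_W}\mathcal{C}(C,W)\to\mathcal{C}(B,W)$ (other maps induced by $f,g$) are exact. Then $\mathcal{C}=(\mathcal{C},\mathbb{E},\mathfrak{s},\mathbb{E}^{-1})$ is called an extriangulated category with a negative first extension. **Extension-closed subcategories.** For collections of objects $\mathcal{X},\mathcal{Y}$, $\mathcal{X}\ast\mathcal{Y}$ is the subcategory of objects $M$ admitting an $\mathfrak{s}$-conflation $X\to M\to Y\dashrightarrow$ with $X\in\mathcal{X}$, $Y\in\mathcal{Y}$. A subcategory $\mathcal{C}'$ is extension-closed if $\mathcal{C}'\ast\mathcal{C}'\subseteq\mathcal{C}'$;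 then $\mathcal{C}'$ is regarded as an extriangulated category with a negative first extension by restricting the extriangulated structure and the negative first extension structure of $\mathcal{C}$. **$s$-torsion pairs, intervals, hearts.** A pair $(\mathcal{T},\mathcal{F})$ of subcategories of $\mathcal{C}$ is an $s$-torsion pair in $\mathcal{C}$ if (STP1) $\mathcal{C}=\mathcal{T}\ast\mathcal{F}$, (STP2) $\mathcal{C}(\mathcal{T},\mathcal{F})=0$, (STP3) $\mathbb{E}^{-1}(\mathcal{T},\mathcal{F})=0$. The set of $s$-torsion pairs is partially ordered by $(\mathcal{T}_1,\mathcal{F}_1)\le(\mathcal{T}_2,\mathcal{F}_2)$ iff $\mathcal{T}_1\subseteq\mathcal{T}_2$. For $s$-torsion pairs $t_1=(\mathcal{T}_1,\mathcal{F}_1)\le t_2=(\mathcal{T}_2,\mathcal{F}_2)$ in $\mathcal{C}$, the interval $[t_1,t_2]$ is the subposet of all $s$-torsion pairs $t$ in $\mathcal{C}$ with $t_1\le t\le t_2$, and its heart is $\mathcal{H}_{[t_1,t_2]}:=\mathcal{T}_2\cap\mathcal{F}_1$. The heart is extension-closed in $\mathcal{C}$, hence is regarded as an extriangulated category with a negative first extension by restriction from $\mathcal{C}$; $s$-torsion pairs in it, and their order, are taken with respect to this structure. *)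

theory Defs
  imports "HOL-Algebra.Coset"
begin

text \<open>
  Abelian groups are HOL-Algebra's \<open>comm_group\<close>s, hence written multiplicatively: \<open>\<one>\<close> of a Hom-group
  is the zero morphism and \<open>\<otimes>\<close> of a Hom-group is the sum of morphisms. Every structure is a record
  whose axioms only speak about the objects in \<open>Ob\<close>, so a full subcategory is obtained by shrinking
  \<open>Ob\<close>.
\<close>

section \<open>Additive categories\<close>

record ('o, 'm) precategory =
  Ob :: "'o set"
  Dom :: "'m \<Rightarrow> 'o"
  Cod :: "'m \<Rightarrow> 'o"
  Hom :: "'o \<Rightarrow> 'o \<Rightarrow> 'm monoid"
  Id :: "'o \<Rightarrow> 'm"
  Comp :: "'m \<Rightarrow> 'm \<Rightarrow> 'm" (infixr "\<cdot>\<index>" 75)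

abbreviation mor :: "('o, 'm, 'z) precategory_scheme \<Rightarrow> 'o \<Rightarrow> 'o \<Rightarrow> 'm set" where
  "mor \<C> X Y \<equiv> carrier (Hom \<C> X Y)"

abbreviation zero_mor :: "('o, 'm, 'z) precategory_scheme \<Rightarrow> 'o \<Rightarrow> 'o \<Rightarrow> 'm" where
  "zero_mor \<C> X Y \<equiv> \<one>\<^bsub>Hom \<C> X Y\<^esub>"

locale preadditive_category =
  fixes \<C> :: "('o, 'm, 'z) precategory_scheme" (structure)
  assumes dom_cod: "\<lbrakk>X \<in> Ob \<C>; Y \<in> Ob \<C>; f \<in> mor \<C> X Y\<rbrakk> \<Longrightarrow> Dom \<C> f = X \<and> Cod \<C> f = Y"
    and hom_group: "\<lbrakk>X \<in> Ob \<C>; Y \<in> Ob \<C>\<rbrakk> \<Longrightarrow> comm_group (Hom \<C> X Y)"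
    and id_mor: "X \<in> Ob \<C> \<Longrightarrow> Id \<C> X \<in> mor \<C> X X"
    and comp_mor: "\<lbrakk>X \<in> Ob \<C>; Y \<in> Ob \<C>; Z \<in> Ob \<C>; f \<in> mor \<C> X Y; g \<in> mor \<C> Y Z\<rbrakk>
          \<Longrightarrow> g \<cdot> f \<in> mor \<C> X Z"
    and comp_assoc: "\<lbrakk>W \<in> Ob \<C>; X \<in> Ob \<C>; Y \<in> Ob \<C>; Z \<in> Ob \<C>;
          f \<in> mor \<C> W X; g \<in> mor \<C> X Y; h \<in> mor \<C> Y Z\<rbrakk> \<Longrightarrow> (h \<cdot> g) \<cdot> f = h \<cdot> (g \<cdot> f)"
    and id_left: "\<lbrakk>X \<in> Ob \<C>; Y \<in> Ob \<C>; f \<in> mor \<C> X Y\<rbrakk> \<Longrightarrow> Id \<C> Y \<cdot> f = f"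
    and id_right: "\<lbrakk>X \<in> Ob \<C>; Y \<in> Ob \<C>; f \<in> mor \<C> X Y\<rbrakk> \<Longrightarrow> f \<cdot> Id \<C> X = f"
    and comp_add_right: "\<lbrakk>X \<in> Ob \<C>; Y \<in> Ob \<C>; Z \<in> Ob \<C>; f \<in> mor \<C> X Y; f' \<in> mor \<C> X Y; g \<in> mor \<C> Y Z\<rbrakk>
          \<Longrightarrow> g \<cdot> (f \<otimes>\<^bsub>Hom \<C> X Y\<^esub> f') = (g \<cdot> f) \<otimes>\<^bsub>Hom \<C> X Z\<^esub> (g \<cdot> f')"
    and comp_add_left: "\<lbrakk>X \<in> Ob \<C>; Y \<in> Ob \<C>; Z \<in> Ob \<C>; f \<in> mor \<C> X Y; g \<in> mor \<C> Y Z; g' \<in> mor \<C> Y Z\<rbrakk>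
          \<Longrightarrow> (g \<otimes>\<^bsub>Hom \<C> Y Z\<^esub> g') \<cdot> f = (g \<cdot> f) \<otimes>\<^bsub>Hom \<C> X Z\<^esub> (g' \<cdot> f)"

definition zero_object :: "('o, 'm, 'z) precategory_scheme \<Rightarrow> 'o \<Rightarrow> bool" where
  "zero_object \<C> Z \<longleftrightarrow> Z \<in> Ob \<C> \<and>
     (\<forall>X\<in>Ob \<C>. mor \<C> X Z = {zero_mor \<C> X Z} \<and> mor \<C> Z X = {zero_mor \<C> Z X})"

definition biproduct ::
  "('o, 'm, 'z) precategory_scheme \<Rightarrow> 'o \<Rightarrow> 'o \<Rightarrow> 'o \<Rightarrow> 'm \<Rightarrow> 'm \<Rightarrow> 'm \<Rightarrow> 'm \<Rightarrow> bool" where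
  "biproduct \<C> A A' P i i' p p' \<longleftrightarrow>
     A \<in> Ob \<C> \<and> A' \<in> Ob \<C> \<and> P \<in> Ob \<C> \<and>
     i \<in> mor \<C> A P \<and> i' \<in> mor \<C> A' P \<and> p \<in> mor \<C> P A \<and> p' \<in> mor \<C> P A' \<and>
     p \<cdot>\<^bsub>\<C>\<^esub> i = Id \<C> A \<and> p' \<cdot>\<^bsub>\<C>\<^esub> i' = Id \<C> A' \<and>
     p \<cdot>\<^bsub>\<C>\<^esub> i' = zero_mor \<C> A' A \<and> p' \<cdot>\<^bsub>\<C>\<^esub> i = zero_mor \<C> A A' \<and>
     (i \<cdot>\<^bsub>\<C>\<^esub> p) \<otimes>\<^bsub>Hom \<C> P P\<^esub> (i' \<cdot>\<^bsub>\<C>\<^esub> p') = Id \<C> P"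

locale additive_category = preadditive_category +
  assumes ex_zero_object: "\<exists>Z. zero_object \<C> Z"
    and ex_biproduct: "\<lbrakk>A \<in> Ob \<C>; A' \<in> Ob \<C>\<rbrakk> \<Longrightarrow> \<exists>P i i' p p'. biproduct \<C> A A' P i i' p p'"

definition iso_mor :: "('o, 'm, 'z) precategory_scheme \<Rightarrow> 'o \<Rightarrow> 'o \<Rightarrow> 'm \<Rightarrow> bool" where
  "iso_mor \<C> X Y f \<longleftrightarrow> f \<in> mor \<C> X Y \<and>
     (\<exists>g\<in>mor \<C> Y X. g \<cdot>\<^bsub>\<C>\<^esub> f = Id \<C> X \<and> f \<cdot>\<^bsub>\<C>\<^esub> g = Id \<C> Y)"

text \<open>Full subcategories closed under isomorphisms, given by their objects.\<close>

definition subcategory :: "('o, 'm, 'z) precategory_scheme \<Rightarrow> 'o set \<Rightarrow> bool" where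
  "subcategory \<C> S \<longleftrightarrow> S \<subseteq> Ob \<C> \<and>
     (\<forall>X\<in>S. \<forall>Y\<in>Ob \<C>. (\<exists>f. iso_mor \<C> X Y f) \<longrightarrow> Y \<in> S)"

text \<open>
  An additive bifunctor from \<open>\<C>\<^sup>o\<^sup>p \<times> \<C>\<close> to abelian groups: for \<open>c : C' \<rightarrow> C\<close> and \<open>a : A \<rightarrow> A'\<close>
  the map \<open>Fm c a : F C A \<rightarrow> F C' A'\<close> is \<open>F(c, a)\<close>, contravariant in the first argument.
\<close>

locale additive_bifunctor = preadditive_category \<C>
  for \<C> :: "('o, 'm, 'z) precategory_scheme" (structure) +
  fixes F :: "'o \<Rightarrow> 'o \<Rightarrow> 'x monoid" and Fm :: "'m \<Rightarrow> 'm \<Rightarrow> 'x \<Rightarrow> 'x"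
  assumes F_group: "\<lbrakk>C \<in> Ob \<C>; A \<in> Ob \<C>\<rbrakk> \<Longrightarrow> comm_group (F C A)"
    and F_hom: "\<lbrakk>C \<in> Ob \<C>; C' \<in> Ob \<C>; A \<in> Ob \<C>; A' \<in> Ob \<C>; c \<in> mor \<C> C' C; a \<in> mor \<C> A A'\<rbrakk>
          \<Longrightarrow> Fm c a \<in> hom (F C A) (F C' A')"
    and F_id: "\<lbrakk>C \<in> Ob \<C>; A \<in> Ob \<C>; \<xi> \<in> carrier (F C A)\<rbrakk> \<Longrightarrow> Fm (Id \<C> C) (Id \<C> A) \<xi> = \<xi>"
    and F_comp: "\<lbrakk>C \<in> Ob \<C>; C' \<in> Ob \<C>; C'' \<in> Ob \<C>; A \<in> Ob \<C>; A' \<in> Ob \<C>; A'' \<in> Ob \<C>;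
          c \<in> mor \<C> C' C; c' \<in> mor \<C> C'' C'; a \<in> mor \<C> A A'; a' \<in> mor \<C> A' A'';
          \<xi> \<in> carrier (F C A)\<rbrakk> \<Longrightarrow> Fm (c \<cdot> c') (a' \<cdot> a) \<xi> = Fm c' a' (Fm c a \<xi>)"
    and F_add_left: "\<lbrakk>C \<in> Ob \<C>; C' \<in> Ob \<C>; A \<in> Ob \<C>; A' \<in> Ob \<C>;
          c \<in> mor \<C> C' C; d \<in> mor \<C> C' C; a \<in> mor \<C> A A'; \<xi> \<in> carrier (F C A)\<rbrakk>
          \<Longrightarrow> Fm (c \<otimes>\<^bsub>Hom \<C> C' C\<^esub> d) a \<xi> = Fm c a \<xi> \<otimes>\<^bsub>F C' A'\<^esub> Fm d a \<xi>"
    and F_add_right: "\<lbrakk>C \<in> Ob \<C>; C' \<in> Ob \<C>; A \<in> Ob \<C>; A' \<in> Ob \<C>;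
          c \<in> mor \<C> C' C; a \<in> mor \<C> A A'; b \<in> mor \<C> A A'; \<xi> \<in> carrier (F C A)\<rbrakk>
          \<Longrightarrow> Fm c (a \<otimes>\<^bsub>Hom \<C> A A'\<^esub> b) \<xi> = Fm c a \<xi> \<otimes>\<^bsub>F C' A'\<^esub> Fm c b \<xi>"

section \<open>Extriangulated categories\<close>

text \<open>
  \<open>Ext \<C> C A\<close> is \<open>\<E>(C, A)\<close>, \<open>Ext_map \<C> c a\<close> is \<open>\<E>(c, a)\<close>, and for \<open>\<delta> \<in> \<E>(C, A)\<close> the set
  \<open>Realiz \<C> C A \<delta>\<close> is the class \<open>\<s>(\<delta>)\<close>, its members \<open>(x, y)\<close> being the sequences
  \<open>A \<rightarrow> B \<rightarrow> C\<close> representing it.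
\<close>

record ('o, 'm, 'e) pre_extriangulated = "('o, 'm) precategory" +
  Ext :: "'o \<Rightarrow> 'o \<Rightarrow> 'e monoid"
  Ext_map :: "'m \<Rightarrow> 'm \<Rightarrow> 'e \<Rightarrow> 'e"
  Realiz :: "'o \<Rightarrow> 'o \<Rightarrow> 'e \<Rightarrow> ('m \<times> 'm) set"

text \<open>\<open>push \<C> C a \<delta> = a\<^sub>*\<delta>\<close> and \<open>pull \<C> A c \<delta> = c\<^sup>*\<delta>\<close> for \<open>\<delta> \<in> \<E>(C, A)\<close>.\<close>

definition push :: "('o, 'm, 'e, 'z) pre_extriangulated_scheme \<Rightarrow> 'o \<Rightarrow> 'm \<Rightarrow> 'e \<Rightarrow> 'e" where
  "push \<C> C a \<delta> = Ext_map \<C> (Id \<C> C) a \<delta>"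

definition pull :: "('o, 'm, 'e, 'z) pre_extriangulated_scheme \<Rightarrow> 'o \<Rightarrow> 'm \<Rightarrow> 'e \<Rightarrow> 'e" where
  "pull \<C> A c \<delta> = Ext_map \<C> c (Id \<C> A) \<delta>"

definition sequences :: "('o, 'm, 'z) precategory_scheme \<Rightarrow> 'o \<Rightarrow> 'o \<Rightarrow> ('m \<times> 'm) set" where
  "sequences \<C> A C = {(x, y). \<exists>B\<in>Ob \<C>. x \<in> mor \<C> A B \<and> y \<in> mor \<C> B C}"

definition seq_equiv ::
  "('o, 'm, 'z) precategory_scheme \<Rightarrow> 'o \<Rightarrow> 'o \<Rightarrow> (('m \<times> 'm) \<times> ('m \<times> 'm)) set" where
  "seq_equiv \<C> A C = {((x, y), (x', y')).
     \<exists>B\<in>Ob \<C>. \<exists>B'\<in>Ob \<C>. x \<in> mor \<C> A B \<and> y \<in> mor \<C> B C \<and> x' \<in> mor \<C> A B' \<and> y' \<in> mor \<C> B' C \<and>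
       (\<exists>b. iso_mor \<C> B B' b \<and> b \<cdot>\<^bsub>\<C>\<^esub> x = x' \<and> y' \<cdot>\<^bsub>\<C>\<^esub> b = y)}"

definition conflation ::
  "('o, 'm, 'e, 'z) pre_extriangulated_scheme \<Rightarrow> 'o \<Rightarrow> 'o \<Rightarrow> 'o \<Rightarrow> 'm \<Rightarrow> 'm \<Rightarrow> 'e \<Rightarrow> bool" where
  "conflation \<C> A B C x y \<delta> \<longleftrightarrow>
     A \<in> Ob \<C> \<and> B \<in> Ob \<C> \<and> C \<in> Ob \<C> \<and> x \<in> mor \<C> A B \<and> y \<in> mor \<C> B C \<and>
     \<delta> \<in> carrier (Ext \<C> C A) \<and> (x, y) \<in> Realiz \<C> C A \<delta>"

definition realization :: "('o, 'm, 'e, 'z) pre_extriangulated_scheme \<Rightarrow> bool" where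
  "realization \<C> \<longleftrightarrow>
     (\<forall>A\<in>Ob \<C>. \<forall>C\<in>Ob \<C>. \<forall>\<delta>\<in>carrier (Ext \<C> C A). Realiz \<C> C A \<delta> \<in> sequences \<C> A C // seq_equiv \<C> A C) \<and>
     (\<forall>A B C x y \<delta> A' B' C' x' y' \<delta>' a c.
        conflation \<C> A B C x y \<delta> \<longrightarrow> conflation \<C> A' B' C' x' y' \<delta>' \<longrightarrow>
        a \<in> mor \<C> A A' \<longrightarrow> c \<in> mor \<C> C C' \<longrightarrow> push \<C> C a \<delta> = pull \<C> A' c \<delta>' \<longrightarrow>
        (\<exists>b\<in>mor \<C> B B'. b \<cdot>\<^bsub>\<C>\<^esub> x = x' \<cdot>\<^bsub>\<C>\<^esub> a \<and> y' \<cdot>\<^bsub>\<C>\<^esub> b = c \<cdot>\<^bsub>\<C>\<^esub> y))"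

text \<open>
  In the second clause \<open>\<delta> \<oplus> \<delta>' \<in> \<E>(C \<oplus> C', A \<oplus> A')\<close> is the element with matrix entries
  \<open>\<delta>, 0, 0, \<delta>'\<close>, i.e. \<open>\<E>(pr\<^sub>C, in\<^sub>A)(\<delta>) + \<E>(pr\<^sub>C\<^sub>', in\<^sub>A\<^sub>')(\<delta>')\<close>.
\<close>

definition additive_realization :: "('o, 'm, 'e, 'z) pre_extriangulated_scheme \<Rightarrow> bool" where
  "additive_realization \<C> \<longleftrightarrow> realization \<C> \<and>
     (\<forall>A C P i i' p p'. biproduct \<C> A C P i i' p p' \<longrightarrow>
        conflation \<C> A P C i p' \<one>\<^bsub>Ext \<C> C A\<^esub>) \<and>
     (\<forall>A B C x y \<delta> A' B' C' x' y' \<delta>' PA iA iA' pA pA' PB iB iB' pB pB' PC iC iC' pC pC'.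
        conflation \<C> A B C x y \<delta> \<longrightarrow> conflation \<C> A' B' C' x' y' \<delta>' \<longrightarrow>
        biproduct \<C> A A' PA iA iA' pA pA' \<longrightarrow>
        biproduct \<C> B B' PB iB iB' pB pB' \<longrightarrow>
        biproduct \<C> C C' PC iC iC' pC pC' \<longrightarrow>
        conflation \<C> PA PB PC
          ((iB \<cdot>\<^bsub>\<C>\<^esub> x \<cdot>\<^bsub>\<C>\<^esub> pA) \<otimes>\<^bsub>Hom \<C> PA PB\<^esub> (iB' \<cdot>\<^bsub>\<C>\<^esub> x' \<cdot>\<^bsub>\<C>\<^esub> pA'))
          ((iC \<cdot>\<^bsub>\<C>\<^esub> y \<cdot>\<^bsub>\<C>\<^esub> pB) \<otimes>\<^bsub>Hom \<C> PB PC\<^esub> (iC' \<cdot>\<^bsub>\<C>\<^esub> y' \<cdot>\<^bsub>\<C>\<^esub> pB'))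
          (Ext_map \<C> pC iA \<delta> \<otimes>\<^bsub>Ext \<C> PC PA\<^esub> Ext_map \<C> pC' iA' \<delta>'))"

definition ET3 :: "('o, 'm, 'e, 'z) pre_extriangulated_scheme \<Rightarrow> bool" where
  "ET3 \<C> \<longleftrightarrow>
     (\<forall>A B C x y \<delta> A' B' C' x' y' \<delta>' a b.
        conflation \<C> A B C x y \<delta> \<longrightarrow> conflation \<C> A' B' C' x' y' \<delta>' \<longrightarrow>
        a \<in> mor \<C> A A' \<longrightarrow> b \<in> mor \<C> B B' \<longrightarrow> b \<cdot>\<^bsub>\<C>\<^esub> x = x' \<cdot>\<^bsub>\<C>\<^esub> a \<longrightarrow>
        (\<exists>c\<in>mor \<C> C C'. c \<cdot>\<^bsub>\<C>\<^esub> y = y' \<cdot>\<^bsub>\<C>\<^esub> b \<and> push \<C> C a \<delta> = pull \<C> A' c \<delta>'))"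

definition ET4 :: "('o, 'm, 'e, 'z) pre_extriangulated_scheme \<Rightarrow> bool" where
  "ET4 \<C> \<longleftrightarrow>
     (\<forall>A B C D F f f' g g' \<delta> \<delta>'.
        conflation \<C> A B D f f' \<delta> \<longrightarrow> conflation \<C> B C F g g' \<delta>' \<longrightarrow>
        (\<exists>E\<in>Ob \<C>. \<exists>h'\<in>mor \<C> C E. \<exists>d\<in>mor \<C> D E. \<exists>e\<in>mor \<C> E F. \<exists>\<delta>''\<in>carrier (Ext \<C> E A).
           d \<cdot>\<^bsub>\<C>\<^esub> f' = h' \<cdot>\<^bsub>\<C>\<^esub> g \<and> e \<cdot>\<^bsub>\<C>\<^esub> h' = g' \<and>
           conflation \<C> A C E (g \<cdot>\<^bsub>\<C>\<^esub> f) h' \<delta>'' \<and>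
           conflation \<C> D E F d e (push \<C> F f' \<delta>') \<and>
           pull \<C> A d \<delta>'' = \<delta> \<and> push \<C> E f \<delta>'' = pull \<C> B e \<delta>'))"

definition opposite ::
  "('o, 'm, 'e, 'z) pre_extriangulated_scheme \<Rightarrow> ('o, 'm, 'e) pre_extriangulated" where
  "opposite \<C> = \<lparr>
     Ob = Ob \<C>,
     Dom = Cod \<C>,
     Cod = Dom \<C>,
     Hom = (\<lambda>X Y. Hom \<C> Y X),
     Id = Id \<C>,
     Comp = (\<lambda>g f. f \<cdot>\<^bsub>\<C>\<^esub> g),
     Ext = (\<lambda>C A. Ext \<C> A C),
     Ext_map = (\<lambda>c a. Ext_map \<C> a c),
     Realiz = (\<lambda>C A \<delta>. {(x, y). (y, x) \<in> Realiz \<C> A C \<delta>})\<rparr>"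

locale extriangulated_category = additive_category \<C> + Ext: additive_bifunctor \<C> "Ext \<C>" "Ext_map \<C>"
  for \<C> :: "('o, 'm, 'e, 'z) pre_extriangulated_scheme" (structure) +
  assumes ET2: "additive_realization \<C>"
    and ET3: "ET3 \<C>"
    and ET4: "ET4 \<C>"
    and ET3_op: "ET3 (opposite \<C>)"
    and ET4_op: "ET4 (opposite \<C>)"

section \<open>Negative first extensions\<close>

text \<open>
  For \<open>\<delta> \<in> \<E>(C, A)\<close>, \<open>sharp_cov \<C> C A \<delta> W : \<E>\<^sup>-\<^sup>1(W, C) \<rightarrow> \<C>(W, A)\<close> and
  \<open>sharp_con \<C> C A \<delta> W : \<E>\<^sup>-\<^sup>1(A, W) \<rightarrow> \<C>(C, W)\<close> are the components at \<open>W\<close> of the two natural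
  transformations attached to \<open>\<delta>\<close>.
\<close>

record ('o, 'm, 'e, 'n) pre_neg_extriangulated = "('o, 'm, 'e) pre_extriangulated" +
  Neg :: "'o \<Rightarrow> 'o \<Rightarrow> 'n monoid"
  Neg_map :: "'m \<Rightarrow> 'm \<Rightarrow> 'n \<Rightarrow> 'n"
  sharp_cov :: "'o \<Rightarrow> 'o \<Rightarrow> 'e \<Rightarrow> 'o \<Rightarrow> 'n \<Rightarrow> 'm"
  sharp_con :: "'o \<Rightarrow> 'o \<Rightarrow> 'e \<Rightarrow> 'o \<Rightarrow> 'n \<Rightarrow> 'm"

definition exact_at ::
  "('a, 'r) monoid_scheme \<Rightarrow> ('b, 's) monoid_scheme \<Rightarrow> ('c, 't) monoid_scheme
     \<Rightarrow> ('a \<Rightarrow> 'b) \<Rightarrow> ('b \<Rightarrow> 'c) \<Rightarrow> bool" where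
  "exact_at G H K u v \<longleftrightarrow> u ` carrier G = kernel H K v"

locale neg_extriangulated_category =
  extriangulated_category \<C> + Neg: additive_bifunctor \<C> "Neg \<C>" "Neg_map \<C>"
  for \<C> :: "('o, 'm, 'e, 'n, 'z) pre_neg_extriangulated_scheme" (structure) +
  assumes sharp_cov_hom: "\<lbrakk>A \<in> Ob \<C>; C \<in> Ob \<C>; \<delta> \<in> carrier (Ext \<C> C A); W \<in> Ob \<C>\<rbrakk>
        \<Longrightarrow> sharp_cov \<C> C A \<delta> W \<in> hom (Neg \<C> W C) (Hom \<C> W A)"
    and sharp_cov_natural: "\<lbrakk>A \<in> Ob \<C>; C \<in> Ob \<C>; \<delta> \<in> carrier (Ext \<C> C A);
          W \<in> Ob \<C>; W' \<in> Ob \<C>; w \<in> mor \<C> W' W; \<eta> \<in> carrier (Neg \<C> W C)\<rbrakk>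
        \<Longrightarrow> sharp_cov \<C> C A \<delta> W' (Neg_map \<C> w (Id \<C> C) \<eta>) = sharp_cov \<C> C A \<delta> W \<eta> \<cdot> w"
    and sharp_con_hom: "\<lbrakk>A \<in> Ob \<C>; C \<in> Ob \<C>; \<delta> \<in> carrier (Ext \<C> C A); W \<in> Ob \<C>\<rbrakk>
        \<Longrightarrow> sharp_con \<C> C A \<delta> W \<in> hom (Neg \<C> A W) (Hom \<C> C W)"
    and sharp_con_natural: "\<lbrakk>A \<in> Ob \<C>; C \<in> Ob \<C>; \<delta> \<in> carrier (Ext \<C> C A);
          W \<in> Ob \<C>; W' \<in> Ob \<C>; w \<in> mor \<C> W W'; \<eta> \<in> carrier (Neg \<C> A W)\<rbrakk>
        \<Longrightarrow> sharp_con \<C> C A \<delta> W' (Neg_map \<C> (Id \<C> A) w \<eta>) = w \<cdot> sharp_con \<C> C A \<delta> W \<eta>"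
    and exact_cov: "\<lbrakk>conflation \<C> A B C f g \<delta>; W \<in> Ob \<C>\<rbrakk> \<Longrightarrow>
        exact_at (Neg \<C> W A) (Neg \<C> W B) (Neg \<C> W C)
          (Neg_map \<C> (Id \<C> W) f) (Neg_map \<C> (Id \<C> W) g) \<and>
        exact_at (Neg \<C> W B) (Neg \<C> W C) (Hom \<C> W A)
          (Neg_map \<C> (Id \<C> W) g) (sharp_cov \<C> C A \<delta> W) \<and>
        exact_at (Neg \<C> W C) (Hom \<C> W A) (Hom \<C> W B)
          (sharp_cov \<C> C A \<delta> W) (\<lambda>h. f \<cdot> h)"
    and exact_con: "\<lbrakk>conflation \<C> A B C f g \<delta>; W \<in> Ob \<C>\<rbrakk> \<Longrightarrow>
        exact_at (Neg \<C> C W) (Neg \<C> B W) (Neg \<C> A W)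
          (Neg_map \<C> g (Id \<C> W)) (Neg_map \<C> f (Id \<C> W)) \<and>
        exact_at (Neg \<C> B W) (Neg \<C> A W) (Hom \<C> C W)
          (Neg_map \<C> f (Id \<C> W)) (sharp_con \<C> C A \<delta> W) \<and>
        exact_at (Neg \<C> A W) (Hom \<C> C W) (Hom \<C> B W)
          (sharp_con \<C> C A \<delta> W) (\<lambda>h. h \<cdot> g)"

section \<open>Torsion pairs, intervals and hearts\<close>

definition star :: "('o, 'm, 'e, 'z) pre_extriangulated_scheme \<Rightarrow> 'o set \<Rightarrow> 'o set \<Rightarrow> 'o set" where
  "star \<C> \<X> \<Y> = {M \<in> Ob \<C>. \<exists>X\<in>\<X>. \<exists>Y\<in>\<Y>. \<exists>x y \<delta>. conflation \<C> X M Y x y \<delta>}"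

text \<open>
  Restriction of all structure to the full subcategory on \<open>S\<close>. The classes \<open>\<s>(\<delta>)\<close> need no change:
  if \<open>S\<close> is extension-closed (\<open>star \<C> S S \<subseteq> S\<close>), then for \<open>\<delta> \<in> \<E>(C, A)\<close> with \<open>A, C \<in> S\<close> every
  representative of \<open>\<s>(\<delta>)\<close> already lies in \<open>S\<close>.
\<close>

definition restrict_to ::
  "('o, 'm, 'z) precategory_scheme \<Rightarrow> 'o set \<Rightarrow> ('o, 'm, 'z) precategory_scheme" where
  "restrict_to \<C> S = \<C>\<lparr>Ob := S\<rparr>"

definition s_torsion_pairs ::
  "('o, 'm, 'e, 'n, 'z) pre_neg_extriangulated_scheme \<Rightarrow> ('o set \<times> 'o set) set" where
  "s_torsion_pairs \<C> = {(\<T>, \<F>). subcategory \<C> \<T> \<and> subcategory \<C> \<F> \<and>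
     Ob \<C> = star \<C> \<T> \<F> \<and>
     (\<forall>X\<in>\<T>. \<forall>Y\<in>\<F>. mor \<C> X Y = {zero_mor \<C> X Y}) \<and>
     (\<forall>X\<in>\<T>. \<forall>Y\<in>\<F>. carrier (Neg \<C> X Y) = {\<one>\<^bsub>Neg \<C> X Y\<^esub>})}"

definition stp_le :: "'o set \<times> 'o set \<Rightarrow> 'o set \<times> 'o set \<Rightarrow> bool" where
  "stp_le t t' \<longleftrightarrow> fst t \<subseteq> fst t'"

definition stp_interval ::
  "('o, 'm, 'e, 'n, 'z) pre_neg_extriangulated_scheme \<Rightarrow> 'o set \<times> 'o set \<Rightarrow> 'o set \<times> 'o set
     \<Rightarrow> ('o set \<times> 'o set) set" where
  "stp_interval \<C> t\<^sub>1 t\<^sub>2 = {t \<in> s_torsion_pairs \<C>. stp_le t\<^sub>1 t \<and> stp_le t t\<^sub>2}"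

definition heart :: "'o set \<times> 'o set \<Rightarrow> 'o set \<times> 'o set \<Rightarrow> 'o set" where
  "heart t\<^sub>1 t\<^sub>2 = fst t\<^sub>2 \<inter> snd t\<^sub>1"

definition poset_iso :: "'a set \<Rightarrow> ('a \<Rightarrow> 'a \<Rightarrow> bool) \<Rightarrow> 'b set \<Rightarrow> ('b \<Rightarrow> 'b \<Rightarrow> bool) \<Rightarrow> ('a \<Rightarrow> 'b) \<Rightarrow> bool" where
  "poset_iso P r Q r' \<phi> \<longleftrightarrow> bij_betw \<phi> P Q \<and> (\<forall>p\<in>P. \<forall>q\<in>P. r p q \<longleftrightarrow> r' (\<phi> p) (\<phi> q))"

end

theory Submission
  imports Defs
begin

text \<open>
  The isomorphism sends \<open>(\<T>, \<F>)\<close> to \<open>(\<T> \<inter> \<F>\<^sub>1, \<T>\<^sub>2 \<inter> \<F>)\<close>; its inverse sends \<open>(\<X>, \<Y>)\<close> to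
  \<open>(\<T>\<^sub>1 * \<X>, \<Y> * \<F>\<^sub>2)\<close>. Everything rests on the fact that an \<open>s\<close>-torsion pair is determined by
  vanishing of morphisms alone: if \<open>X \<rightarrow> M \<rightarrow> Y\<close> is a conflation with \<open>\<E>\<^sup>-\<^sup>1(X, Y) = 0\<close> and
  \<open>M \<rightarrow> Y\<close> is zero, then \<open>X \<rightarrow> M\<close> is a split epimorphism by half-exactness of \<open>\<C>(M, -)\<close>, while
  \<open>\<C>(X, X) \<rightarrow> \<C>(X, M)\<close> is injective by the negative extension sequence, so it is an isomorphism. Decompositions
  with respect to \<open>(\<T>\<^sub>1 * \<X>, \<Y> * \<F>\<^sub>2)\<close> come from decomposing with \<open>t\<^sub>2\<close>, then \<open>t\<^sub>1\<close>, then in the heart,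
  and reassembling with (ET4)\<open>\<^sup>o\<^sup>p\<close> and (ET4).
\<close>

section \<open>Zero morphisms, biproducts with a zero object, isomorphisms\<close>

context preadditive_category
begin

lemma zero_mor_closed:
  assumes "X \<in> Ob \<C>" "Y \<in> Ob \<C>"
  shows "zero_mor \<C> X Y \<in> mor \<C> X Y"
proof -
  interpret comm_group "Hom \<C> X Y" using hom_group assms by blast
  show ?thesis by simp
qed

lemma comp_zero_right:
  assumes "X \<in> Ob \<C>" "Y \<in> Ob \<C>" "Z \<in> Ob \<C>" "g \<in> mor \<C> Y Z"
  shows "g \<cdot> zero_mor \<C> X Y = zero_mor \<C> X Z"
proof -
  interpret G: comm_group "Hom \<C> X Y" using hom_group assms by blast
  interpret H: comm_group "Hom \<C> X Z" using hom_group assms by blast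
  have "g \<cdot> zero_mor \<C> X Y \<otimes>\<^bsub>Hom \<C> X Z\<^esub> g \<cdot> zero_mor \<C> X Y = g \<cdot> zero_mor \<C> X Y"
    using comp_add_right[of X Y Z "zero_mor \<C> X Y" "zero_mor \<C> X Y" g] assms by simp
  moreover have "g \<cdot> zero_mor \<C> X Y \<in> mor \<C> X Z" using comp_mor[of X Y Z] assms by simp
  ultimately show ?thesis by (metis H.l_cancel_one)
qed

lemma comp_zero_left:
  assumes "X \<in> Ob \<C>" "Y \<in> Ob \<C>" "Z \<in> Ob \<C>" "f \<in> mor \<C> X Y"
  shows "zero_mor \<C> Y Z \<cdot> f = zero_mor \<C> X Z"
proof -
  interpret G: comm_group "Hom \<C> Y Z" using hom_group assms by blast
  interpret H: comm_group "Hom \<C> X Z" using hom_group assms by blast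
  have "zero_mor \<C> Y Z \<cdot> f \<otimes>\<^bsub>Hom \<C> X Z\<^esub> zero_mor \<C> Y Z \<cdot> f = zero_mor \<C> Y Z \<cdot> f"
    using comp_add_left[of X Y Z f "zero_mor \<C> Y Z" "zero_mor \<C> Y Z"] assms by simp
  moreover have "zero_mor \<C> Y Z \<cdot> f \<in> mor \<C> X Z" using comp_mor[of X Y Z] assms by simp
  ultimately show ?thesis by (metis H.l_cancel_one)
qed

lemma comp_left_hom:
  assumes "X \<in> Ob \<C>" "Y \<in> Ob \<C>" "Z \<in> Ob \<C>" "g \<in> mor \<C> Y Z"
  shows "(\<lambda>f. g \<cdot> f) \<in> hom (Hom \<C> X Y) (Hom \<C> X Z)"
  using assms by (auto simp: hom_def comp_mor[of X Y Z] comp_add_right[of X Y Z])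

lemma comp_right_hom:
  assumes "X \<in> Ob \<C>" "Y \<in> Ob \<C>" "Z \<in> Ob \<C>" "f \<in> mor \<C> X Y"
  shows "(\<lambda>g. g \<cdot> f) \<in> hom (Hom \<C> Y Z) (Hom \<C> X Z)"
  using assms by (auto simp: hom_def comp_mor[of X Y Z] comp_add_left[of X Y Z])

lemma biproduct_zero_right:
  assumes A: "A \<in> Ob \<C>" and Z: "zero_object \<C> Z"
  shows "biproduct \<C> A Z A (Id \<C> A) (zero_mor \<C> Z A) (Id \<C> A) (zero_mor \<C> A Z)"
proof -
  have ZO: "Z \<in> Ob \<C>" using Z by (simp add: zero_object_def)
  interpret G: comm_group "Hom \<C> A A" using hom_group A by blast
  have "Id \<C> Z = zero_mor \<C> Z Z" using Z id_mor[OF ZO] by (auto simp: zero_object_def)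
  then show ?thesis
    using A ZO id_mor[OF A] zero_mor_closed
    by (simp add: biproduct_def id_left[of A A] id_left[of Z A] id_right[of A Z] id_left[of Z A]
        comp_zero_right[of _ A Z] comp_zero_right[of _ Z A] comp_zero_left[of _ A Z])
qed

lemma biproduct_zero_left:
  assumes A: "A \<in> Ob \<C>" and Z: "zero_object \<C> Z"
  shows "biproduct \<C> Z A A (zero_mor \<C> Z A) (Id \<C> A) (zero_mor \<C> A Z) (Id \<C> A)"
proof -
  have ZO: "Z \<in> Ob \<C>" using Z by (simp add: zero_object_def)
  interpret G: comm_group "Hom \<C> A A" using hom_group A by blast
  have "Id \<C> Z = zero_mor \<C> Z Z" using Z id_mor[OF ZO] by (auto simp: zero_object_def)
  then show ?thesis
    using A ZO id_mor[OF A] zero_mor_closed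
    by (simp add: biproduct_def id_left[of A A] id_left[of Z A] id_right[of A Z] id_left[of Z A]
        comp_zero_right[of _ A Z] comp_zero_right[of _ Z A] comp_zero_left[of _ A Z])
qed

lemma iso_mor_sym: "iso_mor \<C> X Y f \<Longrightarrow> \<exists>g. iso_mor \<C> Y X g"
  unfolding iso_mor_def by blast

lemma iso_mor_comp:
  assumes "X \<in> Ob \<C>" "Y \<in> Ob \<C>" "Z \<in> Ob \<C>" "iso_mor \<C> X Y f" "iso_mor \<C> Y Z g"
  shows "iso_mor \<C> X Z (g \<cdot> f)"
proof -
  obtain f' where f: "f \<in> mor \<C> X Y" "f' \<in> mor \<C> Y X" "f' \<cdot> f = Id \<C> X" "f \<cdot> f' = Id \<C> Y"
    using assms(4) unfolding iso_mor_def by blast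
  obtain g' where g: "g \<in> mor \<C> Y Z" "g' \<in> mor \<C> Z Y" "g' \<cdot> g = Id \<C> Y" "g \<cdot> g' = Id \<C> Z"
    using assms(5) unfolding iso_mor_def by blast
  have 1: "f' \<cdot> g' \<in> mor \<C> Z X" "g \<cdot> f \<in> mor \<C> X Z" using comp_mor assms(1-3) f g by blast+
  have "(f' \<cdot> g') \<cdot> (g \<cdot> f) = f' \<cdot> (g' \<cdot> (g \<cdot> f))" using comp_assoc[of X Z Y X] assms(1-3) f g 1 by blast
  also have "g' \<cdot> (g \<cdot> f) = f" using comp_assoc[of X Y Z Y f g g'] assms(1-3) f g id_left[of X Y f] by simp
  finally have 2: "(f' \<cdot> g') \<cdot> (g \<cdot> f) = Id \<C> X" using f by simp
  have "(g \<cdot> f) \<cdot> (f' \<cdot> g') = g \<cdot> (f \<cdot> (f' \<cdot> g'))" using comp_assoc[of Z X Y Z] assms(1-3) f g 1 by blast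
  also have "f \<cdot> (f' \<cdot> g') = g'" using comp_assoc[of Z Y X Y g' f' f] assms(1-3) f g id_left[of Z Y g'] by simp
  finally have "(g \<cdot> f) \<cdot> (f' \<cdot> g') = Id \<C> Z" using g by simp
  with 1 2 show ?thesis unfolding iso_mor_def by blast
qed

end

lemma conflation_opposite:
  "conflation (opposite \<C>) A B C x y \<delta> \<longleftrightarrow> conflation \<C> C B A y x \<delta>"
  by (auto simp: conflation_def opposite_def)

lemma conflation_restrict_to:
  "S \<subseteq> Ob \<C> \<Longrightarrow> conflation (restrict_to \<C> S) A B C x y \<delta> \<longleftrightarrow>
     A \<in> S \<and> B \<in> S \<and> C \<in> S \<and> conflation \<C> A B C x y \<delta>"
  by (auto simp: conflation_def restrict_to_def)

section \<open>The dual axioms, half-exactness of Hom, and the operation \<open>star\<close>\<close>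

context extriangulated_category
begin

lemma conflation_D:
  assumes "conflation \<C> A B C x y \<delta>"
  shows "A \<in> Ob \<C>" "B \<in> Ob \<C>" "C \<in> Ob \<C>" "x \<in> mor \<C> A B" "y \<in> mor \<C> B C"
    "\<delta> \<in> carrier (Ext \<C> C A)"
  using assms by (auto simp: conflation_def)

text \<open>(ET3) in the opposite category, with the two conflations exchanged and the clause on
  extensions dropped: only the completed morphism is needed for factorisations.\<close>

lemma ET3_opD:
  assumes "conflation \<C> A B C x y \<delta>" "conflation \<C> A' B' C' x' y' \<delta>'"
    "b \<in> mor \<C> B B'" "c \<in> mor \<C> C C'" "y' \<cdot> b = c \<cdot> y"
  shows "\<exists>a\<in>mor \<C> A A'. x' \<cdot> a = b \<cdot> x"
proof -
  have "conflation (opposite \<C>) C' B' A' y' x' \<delta>'" "conflation (opposite \<C>) C B A y x \<delta>"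
    using assms by (simp_all add: conflation_opposite)
  moreover have "c \<in> mor (opposite \<C>) C' C" "b \<in> mor (opposite \<C>) B' B"
    "b \<cdot>\<^bsub>opposite \<C>\<^esub> y' = y \<cdot>\<^bsub>opposite \<C>\<^esub> c"
    using assms by (auto simp: opposite_def)
  ultimately have "\<exists>a\<in>mor (opposite \<C>) A' A. a \<cdot>\<^bsub>opposite \<C>\<^esub> x' = x \<cdot>\<^bsub>opposite \<C>\<^esub> b"
    using ET3_op unfolding ET3_def by blast
  then show ?thesis by (auto simp: opposite_def)
qed

text \<open>Two composable deflations \<open>g\<close> and \<open>f\<close>, with \<open>D\<close>
  and \<open>F\<close> the first terms for \<open>f\<close> and \<open>g\<close>. Only the two new
  conflations of the dual octahedron are kept, since these suffice for membership in classes of the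
  form \<open>star\<close>.\<close>

lemma ET4_opD:
  assumes "conflation \<C> D B A f' f \<delta>" "conflation \<C> F C B g' g \<delta>'"
  shows "\<exists>E h' d e \<delta>\<^sub>1 \<delta>\<^sub>2. conflation \<C> E C A h' (f \<cdot> g) \<delta>\<^sub>1 \<and> conflation \<C> F E D e d \<delta>\<^sub>2"
proof -
  have c: "conflation (opposite \<C>) A B D f f' \<delta>" "conflation (opposite \<C>) B C F g g' \<delta>'"
    using assms by (simp_all add: conflation_opposite)
  have "\<exists>E h' d e \<delta>\<^sub>1 \<delta>\<^sub>2. conflation (opposite \<C>) A C E (g \<cdot>\<^bsub>opposite \<C>\<^esub> f) h' \<delta>\<^sub>1
      \<and> conflation (opposite \<C>) D E F d e \<delta>\<^sub>2"
    using ET4_op[unfolded ET4_def, rule_format, OF c] by blast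
  then show ?thesis unfolding conflation_opposite by (auto simp: opposite_def)
qed

text \<open>The biproduct of \<open>A\<close> with a zero object can be taken on \<open>A\<close>
  itself, so (ET2) makes this sequence a split conflation. It and its mirror image
  \<open>conflation_zero_id\<close> are the comparison conflations in the factorisation
  lemmas.\<close>

lemma conflation_id_zero:
  assumes "A \<in> Ob \<C>" "zero_object \<C> Z"
  shows "conflation \<C> A A Z (Id \<C> A) (zero_mor \<C> A Z) \<one>\<^bsub>Ext \<C> Z A\<^esub>"
  using ET2 biproduct_zero_right[OF assms] unfolding additive_realization_def by blast

lemma conflation_zero_id:
  assumes "A \<in> Ob \<C>" "zero_object \<C> Z"
  shows "conflation \<C> Z A A (zero_mor \<C> Z A) (Id \<C> A) \<one>\<^bsub>Ext \<C> A Z\<^esub>"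
  using ET2 biproduct_zero_left[OF assms] unfolding additive_realization_def by blast

text \<open>Half-exactness of \<open>\<C>(-, W)\<close> at \<open>B\<close>. Since
  \<open>h \<cdot> x\<close> is zero, \<open>h\<close> and the zero map
  \<open>A \<rightarrow> Z\<close> form a commutative square from the given conflation to
  \<open>Z \<rightarrow> W \<rightarrow> W\<close>; the third component supplied by (ET3) is
  \<open>k\<close>.\<close>

lemma conflation_factor_right:
  assumes c: "conflation \<C> A B C x y \<delta>" and W: "W \<in> Ob \<C>"
    and h: "h \<in> mor \<C> B W" "h \<cdot> x = zero_mor \<C> A W"
  obtains k where "k \<in> mor \<C> C W" "k \<cdot> y = h"
proof -
  note d = conflation_D[OF c]
  obtain Z where Z: "zero_object \<C> Z" using ex_zero_object by blast
  then have ZO: "Z \<in> Ob \<C>" by (simp add: zero_object_def)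
  have "h \<cdot> x = zero_mor \<C> Z W \<cdot> zero_mor \<C> A Z"
    using h comp_zero_right[of A Z W] zero_mor_closed[of Z W] d ZO W by simp
  then have "\<exists>k\<in>mor \<C> C W. k \<cdot> y = Id \<C> W \<cdot> h"
    using ET3[unfolded ET3_def, rule_format, OF c conflation_zero_id[OF W Z] _ h(1)]
      zero_mor_closed[of A Z] d ZO by blast
  then show ?thesis using that id_left[of B W h] d W h by auto
qed

text \<open>Dually, half-exactness of \<open>\<C>(W, -)\<close> at \<open>B\<close>: the dual of
  (ET3) compares \<open>W \<rightarrow> W \<rightarrow> Z\<close> with the given conflation.\<close>

lemma conflation_factor_left:
  assumes c: "conflation \<C> A B C x y \<delta>" and W: "W \<in> Ob \<C>"
    and h: "h \<in> mor \<C> W B" "y \<cdot> h = zero_mor \<C> W C"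
  obtains k where "k \<in> mor \<C> W A" "x \<cdot> k = h"
proof -
  note d = conflation_D[OF c]
  obtain Z where Z: "zero_object \<C> Z" using ex_zero_object by blast
  then have ZO: "Z \<in> Ob \<C>" by (simp add: zero_object_def)
  have "y \<cdot> h = zero_mor \<C> Z C \<cdot> zero_mor \<C> W Z"
    using h comp_zero_right[of W Z C] zero_mor_closed[of Z C] d ZO W by simp
  then have "\<exists>k\<in>mor \<C> W A. x \<cdot> k = h \<cdot> Id \<C> W"
    using ET3_opD[OF conflation_id_zero[OF W Z] c h(1)] zero_mor_closed[of Z C] d ZO by blast
  then show ?thesis using that id_right[of W B h] d W h by auto
qed

lemma mor_middle_zero_left:
  assumes c: "conflation \<C> A B C x y \<delta>" and W: "W \<in> Ob \<C>"
    and "mor \<C> A W = {zero_mor \<C> A W}" "mor \<C> C W = {zero_mor \<C> C W}"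
  shows "mor \<C> B W = {zero_mor \<C> B W}"
proof -
  note d = conflation_D[OF c]
  have "h = zero_mor \<C> B W" if h: "h \<in> mor \<C> B W" for h
  proof -
    have "h \<cdot> x = zero_mor \<C> A W" using comp_mor[of A B W x h] d W h assms(3) by blast
    from conflation_factor_right[OF c W h this] obtain k where "k \<in> mor \<C> C W" "k \<cdot> y = h" .
    then show ?thesis using comp_zero_left[of B C W y] assms(4) d W by simp
  qed
  then show ?thesis using zero_mor_closed[of B W] d W by blast
qed

lemma mor_middle_zero_right:
  assumes c: "conflation \<C> A B C x y \<delta>" and W: "W \<in> Ob \<C>"
    and "mor \<C> W A = {zero_mor \<C> W A}" "mor \<C> W C = {zero_mor \<C> W C}"
  shows "mor \<C> W B = {zero_mor \<C> W B}"
proof -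
  note d = conflation_D[OF c]
  have "h = zero_mor \<C> W B" if h: "h \<in> mor \<C> W B" for h
  proof -
    have "y \<cdot> h = zero_mor \<C> W C" using comp_mor[of W B C h y] d W h assms(4) by blast
    from conflation_factor_left[OF c W h this] obtain k where "k \<in> mor \<C> W A" "x \<cdot> k = h" .
    then show ?thesis using comp_zero_right[of W A B x] assms(3) d W by simp
  qed
  then show ?thesis using zero_mor_closed[of W B] d W by blast
qed

text \<open>The set \<open>Realiz\<close> is a full equivalence class, so the sequence can be
  transported along \<open>f\<close> to the new middle term with the same extension.\<close>

lemma conflation_iso:
  assumes c: "conflation \<C> A B C x y \<delta>" and B': "B' \<in> Ob \<C>" and f: "iso_mor \<C> B B' f"
  shows "\<exists>x' y'. conflation \<C> A B' C x' y' \<delta>"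
proof -
  note d = conflation_D[OF c]
  obtain g where g: "f \<in> mor \<C> B B'" "g \<in> mor \<C> B' B" "g \<cdot> f = Id \<C> B" "f \<cdot> g = Id \<C> B'"
    using f unfolding iso_mor_def by blast
  have "Realiz \<C> C A \<delta> \<in> sequences \<C> A C // seq_equiv \<C> A C"
    using conjunct1[OF ET2[unfolded additive_realization_def]] d(1,3,6)
    unfolding realization_def by simp
  \<comment> \<open>The class is presented by some representative \<open>(u, v)\<close> that may
    differ from \<open>(x, y)\<close>. The transported sequence is therefore compared with
    \<open>(u, v)\<close>, through the composite \<open>f \<cdot> b\<close>.\<close>
  then obtain u v where R: "Realiz \<C> C A \<delta> = seq_equiv \<C> A C `` {(u, v)}"
    unfolding quotient_def by auto
  then have "((u, v), (x, y)) \<in> seq_equiv \<C> A C" using c unfolding conflation_def by blast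
  then obtain B0 B1 b where b: "B0 \<in> Ob \<C>" "B1 \<in> Ob \<C>" "u \<in> mor \<C> A B0" "v \<in> mor \<C> B0 C"
      "x \<in> mor \<C> A B1" "y \<in> mor \<C> B1 C" "iso_mor \<C> B0 B1 b" "b \<cdot> u = x" "y \<cdot> b = v"
    unfolding seq_equiv_def by blast
  \<comment> \<open>\<open>seq_equiv\<close> brings its own middle object; it is \<open>B\<close>
    because a morphism determines its codomain.\<close>
  have "B1 = B" using dom_cod[of A B1 x] dom_cod[of A B x] b d by simp
  note b = b[unfolded this]
  have bm: "b \<in> mor \<C> B0 B" using b unfolding iso_mor_def by blast
  have fx: "f \<cdot> x \<in> mor \<C> A B'" and yg: "y \<cdot> g \<in> mor \<C> B' C"
    using comp_mor[of A B B'] comp_mor[of B' B C] d g B' by blast+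
  have 1: "(f \<cdot> b) \<cdot> u = f \<cdot> x" using comp_assoc[of A B0 B B' u b f] d g b bm B' by simp
  have "(y \<cdot> g) \<cdot> (f \<cdot> b) = y \<cdot> (g \<cdot> (f \<cdot> b))"
    using comp_assoc[of B0 B' B C "f \<cdot> b" g y] comp_mor[of B0 B B' b f] d g b bm B' by blast
  also have "g \<cdot> (f \<cdot> b) = b"
    using comp_assoc[of B0 B B' B b f g] id_left[of B0 B b] d g b bm B' by simp
  finally have 2: "(y \<cdot> g) \<cdot> (f \<cdot> b) = v" using b by simp
  have "((u, v), (f \<cdot> x, y \<cdot> g)) \<in> seq_equiv \<C> A C"
    unfolding seq_equiv_def
    using b fx yg B' 1 2 iso_mor_comp[of B0 B B' b f] d f by blast
  then have "(f \<cdot> x, y \<cdot> g) \<in> Realiz \<C> C A \<delta>" using R by blast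
  then show ?thesis using d B' fx yg unfolding conflation_def by blast
qed

lemma starI: "conflation \<C> X M Y x y \<delta> \<Longrightarrow> X \<in> \<X> \<Longrightarrow> Y \<in> \<Y> \<Longrightarrow> M \<in> star \<C> \<X> \<Y>"
  unfolding star_def using conflation_D(2) by blast

lemma starE:
  assumes "M \<in> star \<C> \<X> \<Y>"
  obtains X Y x y \<delta> where "X \<in> \<X>" "Y \<in> \<Y>" "conflation \<C> X M Y x y \<delta>"
  using assms unfolding star_def by blast

lemma subcategory_star: "subcategory \<C> (star \<C> \<X> \<Y>)"
  unfolding subcategory_def
proof (intro conjI ballI impI)
  show "star \<C> \<X> \<Y> \<subseteq> Ob \<C>" by (auto simp: star_def)
  fix M M' assume "M \<in> star \<C> \<X> \<Y>" "M' \<in> Ob \<C>" "\<exists>f. iso_mor \<C> M M' f"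
  then show "M' \<in> star \<C> \<X> \<Y>" by (meson starE starI conflation_iso)
qed

lemma subcategory_Int: "subcategory \<C> \<X> \<Longrightarrow> subcategory \<C> \<Y> \<Longrightarrow> subcategory \<C> (\<X> \<inter> \<Y>)"
  unfolding subcategory_def by blast

lemma star_mono: "\<X> \<subseteq> \<X>' \<Longrightarrow> \<Y> \<subseteq> \<Y>' \<Longrightarrow> star \<C> \<X> \<Y> \<subseteq> star \<C> \<X>' \<Y>'"
  unfolding star_def by blast

text \<open>The inclusion of \<open>\<T> * (\<X> * \<Y>)\<close> in
  \<open>(\<T> * \<X>) * \<Y>\<close>: the composite deflation
  \<open>A \<rightarrow> N \<rightarrow> Y\<close> has as first term an extension of
  \<open>X\<close> by \<open>T\<close>.\<close>

lemma star_op_assoc: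
  assumes "conflation \<C> T A N x y \<delta>" "N \<in> star \<C> \<X> \<Y>" "T \<in> \<T>"
  shows "A \<in> star \<C> (star \<C> \<T> \<X>) \<Y>"
proof -
  obtain X Y x' y' \<delta>' where X: "X \<in> \<X>" "Y \<in> \<Y>" "conflation \<C> X N Y x' y' \<delta>'"
    using assms(2) by (rule starE)
  show ?thesis using ET4_opD[OF X(3) assms(1)] X(1,2) assms(3) by (meson starI)
qed

text \<open>The opposite regrouping: by (ET4) the composite inflation
  \<open>X \<rightarrow> A \<rightarrow> C\<close> has as last term an extension of \<open>F\<close>
  by \<open>Y\<close>.\<close>

lemma star_assoc:
  assumes "conflation \<C> A C F g g' \<delta>'" "A \<in> star \<C> \<X> \<Y>" "F \<in> \<F>"
  shows "C \<in> star \<C> \<X> (star \<C> \<Y> \<F>)"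
proof -
  obtain X Y x y \<delta> where X: "X \<in> \<X>" "Y \<in> \<Y>" "conflation \<C> X A Y x y \<delta>"
    using assms(2) by (rule starE)
  show ?thesis
    using ET4[unfolded ET4_def, rule_format, OF X(3) assms(1)] X(1,2) assms(3) by (meson starI)
qed

end

section \<open>Consequences of vanishing negative extensions\<close>

context neg_extriangulated_category
begin

text \<open>By exactness at \<open>\<C>(W, A)\<close>, the kernel of composition with
  \<open>x\<close> is the image of the connecting map, whose source \<open>Neg \<C> W C\<close> is
  trivial. Thus \<open>x\<close> behaves like a monomorphism on maps from \<open>W\<close>.\<close>

lemma mor_first_zero:
  assumes c: "conflation \<C> A B C x y \<delta>" and W: "W \<in> Ob \<C>"
    and N: "carrier (Neg \<C> W C) = {\<one>\<^bsub>Neg \<C> W C\<^esub>}"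
    and h: "h \<in> mor \<C> W A" "x \<cdot> h = zero_mor \<C> W B"
  shows "h = zero_mor \<C> W A"
proof -
  note d = conflation_D[OF c]
  interpret G: comm_group "Neg \<C> W C" using Neg.F_group d W by blast
  interpret H: comm_group "Hom \<C> W A" using hom_group d W by blast
  have "sharp_cov \<C> C A \<delta> W \<in> hom (Neg \<C> W C) (Hom \<C> W A)"
    using sharp_cov_hom d W by blast
  then have "sharp_cov \<C> C A \<delta> W \<one>\<^bsub>Neg \<C> W C\<^esub> = zero_mor \<C> W A"
    using hom_one G.is_group H.is_group by blast
  moreover have "h \<in> sharp_cov \<C> C A \<delta> W ` carrier (Neg \<C> W C)"
    using exact_cov[OF c W] h by (simp add: exact_at_def kernel_def)
  ultimately show ?thesis using N by auto
qed

lemma mor_last_zero: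
  assumes c: "conflation \<C> A B C x y \<delta>" and W: "W \<in> Ob \<C>"
    and N: "carrier (Neg \<C> A W) = {\<one>\<^bsub>Neg \<C> A W\<^esub>}"
    and h: "h \<in> mor \<C> C W" "h \<cdot> y = zero_mor \<C> B W"
  shows "h = zero_mor \<C> C W"
proof -
  note d = conflation_D[OF c]
  interpret G: comm_group "Neg \<C> A W" using Neg.F_group d W by blast
  interpret H: comm_group "Hom \<C> C W" using hom_group d W by blast
  have "sharp_con \<C> C A \<delta> W \<in> hom (Neg \<C> A W) (Hom \<C> C W)"
    using sharp_con_hom d W by blast
  then have "sharp_con \<C> C A \<delta> W \<one>\<^bsub>Neg \<C> A W\<^esub> = zero_mor \<C> C W"
    using hom_one G.is_group H.is_group by blast
  moreover have "h \<in> sharp_con \<C> C A \<delta> W ` carrier (Neg \<C> A W)"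
    using exact_con[OF c W] h by (simp add: exact_at_def kernel_def)
  ultimately show ?thesis using N by auto
qed

lemma inflation_cancel:
  assumes c: "conflation \<C> A B C x y \<delta>" and W: "W \<in> Ob \<C>"
    and N: "carrier (Neg \<C> W C) = {\<one>\<^bsub>Neg \<C> W C\<^esub>}"
    and h: "h \<in> mor \<C> W A" "k \<in> mor \<C> W A" "x \<cdot> h = x \<cdot> k"
  shows "h = k"
proof -
  note d = conflation_D[OF c]
  interpret H: comm_group "Hom \<C> W A" using hom_group d W by blast
  interpret K: comm_group "Hom \<C> W B" using hom_group d W by blast
  interpret x: group_hom "Hom \<C> W A" "Hom \<C> W B" "\<lambda>f. x \<cdot> f"
    by unfold_locales (use comp_left_hom d W in blast)
  \<comment> \<open>Composing \<open>x\<close> with the difference of \<open>h\<close> and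
    \<open>k\<close> gives zero; the difference is written multiplicatively.\<close>
  have "h \<otimes>\<^bsub>Hom \<C> W A\<^esub> inv\<^bsub>Hom \<C> W A\<^esub> k = zero_mor \<C> W A"
    by (rule mor_first_zero[OF c W N]) (use h K.r_inv x.hom_closed[of k] in simp_all)
  then show ?thesis using h H.inv_solve_right'[of "\<one>\<^bsub>Hom \<C> W A\<^esub>" h k] by simp
qed

lemma deflation_cancel:
  assumes c: "conflation \<C> A B C x y \<delta>" and W: "W \<in> Ob \<C>"
    and N: "carrier (Neg \<C> A W) = {\<one>\<^bsub>Neg \<C> A W\<^esub>}"
    and h: "h \<in> mor \<C> C W" "k \<in> mor \<C> C W" "h \<cdot> y = k \<cdot> y"
  shows "h = k"
proof -
  note d = conflation_D[OF c]
  interpret H: comm_group "Hom \<C> C W" using hom_group d W by blast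
  interpret K: comm_group "Hom \<C> B W" using hom_group d W by blast
  interpret y: group_hom "Hom \<C> C W" "Hom \<C> B W" "\<lambda>f. f \<cdot> y"
    by unfold_locales (use comp_right_hom d W in blast)
  have "h \<otimes>\<^bsub>Hom \<C> C W\<^esub> inv\<^bsub>Hom \<C> C W\<^esub> k = zero_mor \<C> C W"
    by (rule mor_last_zero[OF c W N]) (use h K.r_inv y.hom_closed[of k] in simp_all)
  then show ?thesis using h H.inv_solve_right'[of "\<one>\<^bsub>Hom \<C> C W\<^esub>" h k] by simp
qed

lemma inflation_iso:
  assumes c: "conflation \<C> X M Y x y \<delta>"
    and N: "carrier (Neg \<C> X Y) = {\<one>\<^bsub>Neg \<C> X Y\<^esub>}" and y: "y = zero_mor \<C> M Y"
  shows "iso_mor \<C> X M x"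
proof -
  note d = conflation_D[OF c]
  have "y \<cdot> Id \<C> M = zero_mor \<C> M Y" using y id_right d by simp
  from conflation_factor_left[OF c d(2) id_mor[OF d(2)] this]
  obtain h where h: "h \<in> mor \<C> M X" "x \<cdot> h = Id \<C> M" .
  have "h \<cdot> x = Id \<C> X"
  proof (rule inflation_cancel[OF c d(1) N])
    show "h \<cdot> x \<in> mor \<C> X X" using comp_mor[of X M X x h] d h by blast
    show "Id \<C> X \<in> mor \<C> X X" using id_mor d by blast
    \<comment> \<open>Both sides equal \<open>x\<close>, so cancelling \<open>x\<close> makes the
      right inverse \<open>h\<close> two-sided.\<close>
    show "x \<cdot> h \<cdot> x = x \<cdot> Id \<C> X"
      using comp_assoc[of X M X M x h x] id_left[of X M x] id_right[of X M x] d h by simp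
  qed
  then show ?thesis using d h unfolding iso_mor_def by blast
qed

text \<open>Dual to \<open>inflation_iso\<close>: \<open>y\<close> is split by factoring the
  identity of \<open>M\<close> through it, and \<open>deflation_cancel\<close> makes the splitting
  an inverse.\<close>

lemma deflation_iso:
  assumes c: "conflation \<C> X M Y x y \<delta>"
    and N: "carrier (Neg \<C> X Y) = {\<one>\<^bsub>Neg \<C> X Y\<^esub>}" and x: "x = zero_mor \<C> X M"
  shows "iso_mor \<C> M Y y"
proof -
  note d = conflation_D[OF c]
  have "Id \<C> M \<cdot> x = zero_mor \<C> X M" using x id_left d by simp
  from conflation_factor_right[OF c d(2) id_mor[OF d(2)] this]
  obtain h where h: "h \<in> mor \<C> Y M" "h \<cdot> y = Id \<C> M" .
  have "y \<cdot> h = Id \<C> Y"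
  proof (rule deflation_cancel[OF c d(3) N])
    show "y \<cdot> h \<in> mor \<C> Y Y" using comp_mor[of Y M Y h y] d h by blast
    show "Id \<C> Y \<in> mor \<C> Y Y" using id_mor d by blast
    show "(y \<cdot> h) \<cdot> y = Id \<C> Y \<cdot> y"
      using comp_assoc[of M Y M Y y h y] id_left[of M Y y] id_right[of M Y y] d h by simp
  qed
  then show ?thesis using d h unfolding iso_mor_def by blast
qed

text \<open>The middle group sits exactly between two trivial groups: the kernel of the outgoing map
  is everything, and the image of the incoming map is trivial.\<close>

lemma Neg_middle_zero_left:
  assumes c: "conflation \<C> A B C x y \<delta>" and W: "W \<in> Ob \<C>"
    and N: "carrier (Neg \<C> A W) = {\<one>\<^bsub>Neg \<C> A W\<^esub>}" "carrier (Neg \<C> C W) = {\<one>\<^bsub>Neg \<C> C W\<^esub>}"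
  shows "carrier (Neg \<C> B W) = {\<one>\<^bsub>Neg \<C> B W\<^esub>}"
proof -
  note d = conflation_D[OF c]
  interpret A: comm_group "Neg \<C> A W" using Neg.F_group d W by blast
  interpret B: comm_group "Neg \<C> B W" using Neg.F_group d W by blast
  interpret C: comm_group "Neg \<C> C W" using Neg.F_group d W by blast
  have fh: "Neg_map \<C> x (Id \<C> W) \<in> hom (Neg \<C> B W) (Neg \<C> A W)"
    and gh: "Neg_map \<C> y (Id \<C> W) \<in> hom (Neg \<C> C W) (Neg \<C> B W)"
    using Neg.F_hom[of B A W W x] Neg.F_hom[of C B W W y] id_mor d W by blast+
  have "kernel (Neg \<C> B W) (Neg \<C> A W) (Neg_map \<C> x (Id \<C> W)) = carrier (Neg \<C> B W)"
    using hom_carrier[OF fh] N unfolding kernel_def by blast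
  moreover have "Neg_map \<C> y (Id \<C> W) ` carrier (Neg \<C> C W) = {\<one>\<^bsub>Neg \<C> B W\<^esub>}"
    using hom_one[OF gh] C.is_group B.is_group N by simp
  ultimately show ?thesis using exact_con[OF c W] unfolding exact_at_def by simp
qed

lemma Neg_middle_zero_right:
  assumes c: "conflation \<C> A B C x y \<delta>" and W: "W \<in> Ob \<C>"
    and N: "carrier (Neg \<C> W A) = {\<one>\<^bsub>Neg \<C> W A\<^esub>}" "carrier (Neg \<C> W C) = {\<one>\<^bsub>Neg \<C> W C\<^esub>}"
  shows "carrier (Neg \<C> W B) = {\<one>\<^bsub>Neg \<C> W B\<^esub>}"
proof -
  note d = conflation_D[OF c]
  interpret A: comm_group "Neg \<C> W A" using Neg.F_group d W by blast
  interpret B: comm_group "Neg \<C> W B" using Neg.F_group d W by blast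
  interpret C: comm_group "Neg \<C> W C" using Neg.F_group d W by blast
  have fh: "Neg_map \<C> (Id \<C> W) x \<in> hom (Neg \<C> W A) (Neg \<C> W B)"
    and gh: "Neg_map \<C> (Id \<C> W) y \<in> hom (Neg \<C> W B) (Neg \<C> W C)"
    using Neg.F_hom[of W W A B _ x] Neg.F_hom[of W W B C _ y] id_mor d W by blast+
  have "kernel (Neg \<C> W B) (Neg \<C> W C) (Neg_map \<C> (Id \<C> W) y) = carrier (Neg \<C> W B)"
    using hom_carrier[OF gh] N unfolding kernel_def by blast
  moreover have "Neg_map \<C> (Id \<C> W) x ` carrier (Neg \<C> W A) = {\<one>\<^bsub>Neg \<C> W B\<^esub>}"
    using hom_one[OF fh] A.is_group B.is_group N by simp
  ultimately show ?thesis using exact_cov[OF c W] unfolding exact_at_def by simp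
qed

section \<open>Orthogonality and s-torsion pairs in full subcategories\<close>

definition orthogonal :: "'o set \<Rightarrow> 'o set \<Rightarrow> bool" where
  "orthogonal \<X> \<Y> \<longleftrightarrow> (\<forall>X\<in>\<X>. \<forall>Y\<in>\<Y>. mor \<C> X Y = {zero_mor \<C> X Y} \<and>
     carrier (Neg \<C> X Y) = {\<one>\<^bsub>Neg \<C> X Y\<^esub>})"

text \<open>Vanishing of morphisms and of negative extensions each passes from the outer terms of a
  conflation to its middle term, so both conditions bundled in \<open>orthogonal\<close> do.\<close>

lemma orthogonal_star_left:
  assumes "orthogonal \<X> \<W>" "orthogonal \<Y> \<W>" "\<W> \<subseteq> Ob \<C>"
  shows "orthogonal (star \<C> \<X> \<Y>) \<W>"
  unfolding orthogonal_def
proof (intro ballI)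
  fix M W assume M: "M \<in> star \<C> \<X> \<Y>" and W: "W \<in> \<W>"
  obtain X Y x y \<delta> where c: "X \<in> \<X>" "Y \<in> \<Y>" "conflation \<C> X M Y x y \<delta>" using M by (rule starE)
  then show "mor \<C> M W = {zero_mor \<C> M W} \<and> carrier (Neg \<C> M W) = {\<one>\<^bsub>Neg \<C> M W\<^esub>}"
    using mor_middle_zero_left[OF c(3)] Neg_middle_zero_left[OF c(3)] assms W
    unfolding orthogonal_def by blast
qed

lemma orthogonal_star_right:
  assumes "orthogonal \<W> \<X>" "orthogonal \<W> \<Y>" "\<W> \<subseteq> Ob \<C>"
  shows "orthogonal \<W> (star \<C> \<X> \<Y>)"
  unfolding orthogonal_def
proof (intro ballI)
  fix M W assume M: "M \<in> star \<C> \<X> \<Y>" and W: "W \<in> \<W>"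
  obtain X Y x y \<delta> where c: "X \<in> \<X>" "Y \<in> \<Y>" "conflation \<C> X M Y x y \<delta>" using M by (rule starE)
  then show "mor \<C> W M = {zero_mor \<C> W M} \<and> carrier (Neg \<C> W M) = {\<one>\<^bsub>Neg \<C> W M\<^esub>}"
    using mor_middle_zero_right[OF c(3)] Neg_middle_zero_right[OF c(3)] assms W
    unfolding orthogonal_def by blast
qed

lemma orthogonal_mono:
  "orthogonal \<X> \<Y> \<Longrightarrow> \<X>' \<subseteq> \<X> \<Longrightarrow> \<Y>' \<subseteq> \<Y> \<Longrightarrow> orthogonal \<X>' \<Y>'"
  unfolding orthogonal_def by blast

text \<open>Expresses torsion pairs of the restriction purely in terms of \<open>\<C>\<close>.
  Taking \<open>\<S>\<close> to be \<open>Ob \<C>\<close> or the heart later lets one set of lemmas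
  serve both.\<close>

lemma s_torsion_pairs_restrict_iff:
  assumes S: "subcategory \<C> \<S>"
  shows "(\<T>, \<F>) \<in> s_torsion_pairs (restrict_to \<C> \<S>) \<longleftrightarrow>
    subcategory \<C> \<T> \<and> subcategory \<C> \<F> \<and> \<T> \<subseteq> \<S> \<and> \<F> \<subseteq> \<S> \<and> \<S> \<subseteq> star \<C> \<T> \<F> \<and> orthogonal \<T> \<F>"
proof -
  have SO: "\<S> \<subseteq> Ob \<C>" using S unfolding subcategory_def by blast
  have sub: "subcategory (restrict_to \<C> \<S>) \<X> \<longleftrightarrow> subcategory \<C> \<X> \<and> \<X> \<subseteq> \<S>" for \<X>
    using S unfolding subcategory_def restrict_to_def iso_mor_def by simp blast
  \<comment> \<open>Conflations of the restriction are those of \<open>\<C>\<close> with all three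
    terms in \<open>\<S>\<close>, so its \<open>star\<close> is cut out of that of
    \<open>\<C>\<close> by \<open>\<S>\<close> and the equality reduces to an inclusion.\<close>
  have star: "\<S> = star (restrict_to \<C> \<S>) \<T> \<F> \<longleftrightarrow> \<S> \<subseteq> star \<C> \<T> \<F>" if "\<T> \<subseteq> \<S>" "\<F> \<subseteq> \<S>"
  proof -
    have "star (restrict_to \<C> \<S>) \<T> \<F> = \<S> \<inter> star \<C> \<T> \<F>"
      unfolding star_def conflation_restrict_to[OF SO] using that SO
      by (auto simp: restrict_to_def) (metis subsetD)+
    then show ?thesis by blast
  qed
  have "(\<T>, \<F>) \<in> s_torsion_pairs (restrict_to \<C> \<S>) \<longleftrightarrow>
    subcategory (restrict_to \<C> \<S>) \<T> \<and> subcategory (restrict_to \<C> \<S>) \<F> \<and>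
    \<S> = star (restrict_to \<C> \<S>) \<T> \<F> \<and> orthogonal \<T> \<F>"
    by (auto simp: s_torsion_pairs_def orthogonal_def restrict_to_def)
  then show ?thesis unfolding sub using star by blast
qed

lemma subcategory_Ob: "subcategory \<C> (Ob \<C>)"
  unfolding subcategory_def by blast

lemma restrict_to_Ob: "restrict_to \<C> (Ob \<C>) = \<C>"
  by (simp add: restrict_to_def)

lemmas s_torsion_pairs_iff =
  s_torsion_pairs_restrict_iff[OF subcategory_Ob, unfolded restrict_to_Ob]

text \<open>In the decomposition of \<open>M\<close> the deflation to the torsion-free part is zero,
  hence \<open>inflation_iso\<close> identifies \<open>M\<close> with its torsion part.\<close>

lemma torsion_class_memI:
  assumes "subcategory \<C> \<S>" "(\<T>, \<F>) \<in> s_torsion_pairs (restrict_to \<C> \<S>)" "M \<in> \<S>"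
    and z: "\<And>Y. Y \<in> \<F> \<Longrightarrow> mor \<C> M Y = {zero_mor \<C> M Y}"
  shows "M \<in> \<T>"
proof -
  note t = assms(2)[unfolded s_torsion_pairs_restrict_iff[OF assms(1)]]
  obtain X Y x y \<delta> where c: "X \<in> \<T>" "Y \<in> \<F>" "conflation \<C> X M Y x y \<delta>"
    using t assms(3) starE by blast
  have "iso_mor \<C> X M x"
    using inflation_iso[OF c(3)] c z conflation_D[OF c(3)] t unfolding orthogonal_def by blast
  then show ?thesis using c conflation_D[OF c(3)] t unfolding subcategory_def by blast
qed

lemma torsion_free_class_memI:
  assumes "subcategory \<C> \<S>" "(\<T>, \<F>) \<in> s_torsion_pairs (restrict_to \<C> \<S>)" "M \<in> \<S>"
    and z: "\<And>X. X \<in> \<T> \<Longrightarrow> mor \<C> X M = {zero_mor \<C> X M}"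
  shows "M \<in> \<F>"
proof -
  note t = assms(2)[unfolded s_torsion_pairs_restrict_iff[OF assms(1)]]
  obtain X Y x y \<delta> where c: "X \<in> \<T>" "Y \<in> \<F>" "conflation \<C> X M Y x y \<delta>"
    using t assms(3) starE by blast
  have "iso_mor \<C> M Y y"
    using deflation_iso[OF c(3)] c z conflation_D[OF c(3)] t unfolding orthogonal_def by blast
  then show ?thesis
    using c conflation_D[OF c(3)] t iso_mor_sym[of M Y y] unfolding subcategory_def by blast
qed

text \<open>An object of \<open>\<F>'\<close> receives only zero morphisms from
  \<open>\<T>'\<close>, hence from \<open>\<T>\<close>, and this already places it in
  \<open>\<F>\<close>.\<close>

lemma torsion_free_class_antimono:
  assumes S: "subcategory \<C> \<S>" and t: "(\<T>, \<F>) \<in> s_torsion_pairs (restrict_to \<C> \<S>)"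
    and t': "(\<T>', \<F>') \<in> s_torsion_pairs (restrict_to \<C> \<S>)" and le: "\<T> \<subseteq> \<T>'"
  shows "\<F>' \<subseteq> \<F>"
proof
  fix M assume M: "M \<in> \<F>'"
  note i' = t'[unfolded s_torsion_pairs_restrict_iff[OF S]]
  show "M \<in> \<F>"
    by (rule torsion_free_class_memI[OF S t]) (use M i' le in \<open>auto simp: orthogonal_def\<close>)
qed

lemma s_torsion_pair_eqI:
  assumes "subcategory \<C> \<S>" "(\<T>, \<F>) \<in> s_torsion_pairs (restrict_to \<C> \<S>)"
    "(\<T>, \<F>') \<in> s_torsion_pairs (restrict_to \<C> \<S>)"
  shows "\<F> = \<F>'"
  using torsion_free_class_antimono assms by (metis subset_antisym subset_refl)

lemmas torsion_class_memI' = torsion_class_memI[OF subcategory_Ob, unfolded restrict_to_Ob]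
lemmas torsion_free_class_memI' = torsion_free_class_memI[OF subcategory_Ob, unfolded restrict_to_Ob]

text \<open>Extension-closure of a torsion class: orthogonality to \<open>\<F>\<close> passes to
  extensions and detects membership.\<close>

lemma star_subset_torsion_class:
  assumes t: "(\<T>, \<F>) \<in> s_torsion_pairs \<C>" and "\<X> \<subseteq> \<T>" "\<Y> \<subseteq> \<T>"
  shows "star \<C> \<X> \<Y> \<subseteq> \<T>"
proof
  fix M assume M: "M \<in> star \<C> \<X> \<Y>"
  note i = t[unfolded s_torsion_pairs_iff]
  have FO: "\<F> \<subseteq> Ob \<C>" using i by blast
  have "orthogonal (star \<C> \<X> \<Y>) \<F>"
    using orthogonal_star_left FO i orthogonal_mono assms(2,3) by blast
  then show "M \<in> \<T>"
    using torsion_class_memI'[OF t] M unfolding orthogonal_def star_def by blast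
qed

text \<open>A map from \<open>C\<close> to a torsion-free \<open>Y\<close> dies after composition
  with \<open>y\<close>, as \<open>B\<close> is torsion. A deflation need not be epic; it is
  \<open>A\<close> being torsion, so that \<open>Neg \<C> A Y\<close> vanishes, that makes the map
  itself zero.\<close>

lemma torsion_class_quotient:
  assumes t: "(\<T>, \<F>) \<in> s_torsion_pairs \<C>"
    and c: "conflation \<C> A B C x y \<delta>" and A: "A \<in> \<T>" and B: "B \<in> \<T>"
  shows "C \<in> \<T>"
proof (rule torsion_class_memI'[OF t])
  note d = conflation_D[OF c]
  note i = t[unfolded s_torsion_pairs_iff]
  show "C \<in> Ob \<C>" by (fact d)
  fix Y assume Y: "Y \<in> \<F>"
  then have YO: "Y \<in> Ob \<C>" using i by blast
  have "h = zero_mor \<C> C Y" if h: "h \<in> mor \<C> C Y" for h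
    using mor_last_zero[OF c YO _ h] comp_mor[OF d(2,3) YO d(5) h] Y A B i
    unfolding orthogonal_def by blast
  then show "mor \<C> C Y = {zero_mor \<C> C Y}" using zero_mor_closed[OF d(3) YO] by blast
qed

lemma torsion_free_class_sub:
  assumes t: "(\<T>, \<F>) \<in> s_torsion_pairs \<C>"
    and c: "conflation \<C> A B C x y \<delta>" and B: "B \<in> \<F>" and C: "C \<in> \<F>"
  shows "A \<in> \<F>"
proof (rule torsion_free_class_memI'[OF t])
  note d = conflation_D[OF c]
  note i = t[unfolded s_torsion_pairs_iff]
  show "A \<in> Ob \<C>" by (fact d)
  fix X assume X: "X \<in> \<T>"
  then have XO: "X \<in> Ob \<C>" using i by blast
  have "h = zero_mor \<C> X A" if h: "h \<in> mor \<C> X A" for h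
    using mor_first_zero[OF c XO _ h] comp_mor[OF XO d(1,2) h d(4)] X B C i
    unfolding orthogonal_def by blast
  then show "mor \<C> X A = {zero_mor \<C> X A}" using zero_mor_closed[OF XO d(1)] by blast
qed

end

section \<open>From the interval to the heart\<close>

locale s_torsion_interval = neg_extriangulated_category \<C>
  for \<C> :: "('o, 'm, 'e, 'n, 'z) pre_neg_extriangulated_scheme" (structure) +
  fixes \<T>\<^sub>1 \<F>\<^sub>1 \<T>\<^sub>2 \<F>\<^sub>2 :: "'o set"
  assumes t1: "(\<T>\<^sub>1, \<F>\<^sub>1) \<in> s_torsion_pairs \<C>"
    and t2: "(\<T>\<^sub>2, \<F>\<^sub>2) \<in> s_torsion_pairs \<C>"
    and T1_T2: "\<T>\<^sub>1 \<subseteq> \<T>\<^sub>2"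
begin

abbreviation \<H> :: "'o set" where "\<H> \<equiv> \<T>\<^sub>2 \<inter> \<F>\<^sub>1"

lemma subcategory_heart: "subcategory \<C> \<H>"
  using t1 t2 subcategory_Int unfolding s_torsion_pairs_iff by blast

lemma antimono: "(\<T>, \<F>) \<in> s_torsion_pairs \<C> \<Longrightarrow> (\<T>', \<F>') \<in> s_torsion_pairs \<C> \<Longrightarrow> \<T> \<subseteq> \<T>' \<Longrightarrow> \<F>' \<subseteq> \<F>"
  using torsion_free_class_antimono[OF subcategory_Ob, unfolded restrict_to_Ob] .

lemma restrict_to_heart:
  assumes t: "(\<T>, \<F>) \<in> s_torsion_pairs \<C>" and le: "\<T>\<^sub>1 \<subseteq> \<T>" "\<T> \<subseteq> \<T>\<^sub>2"
  shows "(\<T> \<inter> \<F>\<^sub>1, \<T>\<^sub>2 \<inter> \<F>) \<in> s_torsion_pairs (restrict_to \<C> \<H>)"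
  unfolding s_torsion_pairs_restrict_iff[OF subcategory_heart]
proof (intro conjI)
  note i = t[unfolded s_torsion_pairs_iff] t1[unfolded s_torsion_pairs_iff] t2[unfolded s_torsion_pairs_iff]
  have F: "\<F> \<subseteq> \<F>\<^sub>1" "\<F>\<^sub>2 \<subseteq> \<F>" using antimono t t1 t2 le by blast+
  show "subcategory \<C> (\<T> \<inter> \<F>\<^sub>1)" "subcategory \<C> (\<T>\<^sub>2 \<inter> \<F>)" using i subcategory_Int by blast+
  show "\<T> \<inter> \<F>\<^sub>1 \<subseteq> \<H>" "\<T>\<^sub>2 \<inter> \<F> \<subseteq> \<H>" using le F by blast+
  have "orthogonal \<T> \<F>" using i by blast
  then show "orthogonal (\<T> \<inter> \<F>\<^sub>1) (\<T>\<^sub>2 \<inter> \<F>)" by (rule orthogonal_mono) auto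
  show "\<H> \<subseteq> star \<C> (\<T> \<inter> \<F>\<^sub>1) (\<T>\<^sub>2 \<inter> \<F>)"
  proof
    fix M assume M: "M \<in> \<H>"
    then have "M \<in> star \<C> \<T> \<F>" using i by blast
    then obtain X Y x y \<delta> where c: "X \<in> \<T>" "Y \<in> \<F>" "conflation \<C> X M Y x y \<delta>" by (rule starE)
    \<comment> \<open>The decomposition of \<open>M\<close> in \<open>\<C>\<close> stays in the
      heart: \<open>M\<close> and \<open>Y\<close> lie in \<open>\<F>\<^sub>1\<close>, which forces
      \<open>X\<close> into it, while \<open>X\<close> and \<open>M\<close> lie in
      \<open>\<T>\<^sub>2\<close>, which forces \<open>Y\<close> into it.\<close>
    have "X \<in> \<F>\<^sub>1" using torsion_free_class_sub[OF t1 c(3)] M c F by blast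
    moreover have "Y \<in> \<T>\<^sub>2" using torsion_class_quotient[OF t2 c(3)] M c le by blast
    ultimately show "M \<in> star \<C> (\<T> \<inter> \<F>\<^sub>1) (\<T>\<^sub>2 \<inter> \<F>)" using c starI by blast
  qed
qed

lemma torsion_class_decompose:
  assumes t: "(\<T>, \<F>) \<in> s_torsion_pairs \<C>" and le: "\<T>\<^sub>1 \<subseteq> \<T>"
    and M: "M \<in> \<T>"
  obtains A N x y \<delta> where "A \<in> \<T>\<^sub>1" "N \<in> \<T> \<inter> \<F>\<^sub>1" "conflation \<C> A M N x y \<delta>"
proof -
  have "M \<in> star \<C> \<T>\<^sub>1 \<F>\<^sub>1" using M t t1 unfolding s_torsion_pairs_iff by blast
  then obtain A N x y \<delta> where c: "A \<in> \<T>\<^sub>1" "N \<in> \<F>\<^sub>1" "conflation \<C> A M N x y \<delta>" by (rule starE)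
  then show ?thesis using that torsion_class_quotient[OF t c(3)] le M by blast
qed

text \<open>Recovers \<open>\<T>\<close> from its trace on \<open>\<F>\<^sub>1\<close>, so that the
  map to the heart reflects the order. The nontrivial inclusion decomposes an object of
  \<open>\<T>\<close> by the first torsion pair.\<close>

lemma torsion_class_eq_star:
  assumes t: "(\<T>, \<F>) \<in> s_torsion_pairs \<C>" and le: "\<T>\<^sub>1 \<subseteq> \<T>"
  shows "star \<C> \<T>\<^sub>1 (\<T> \<inter> \<F>\<^sub>1) = \<T>"
proof
  show "star \<C> \<T>\<^sub>1 (\<T> \<inter> \<F>\<^sub>1) \<subseteq> \<T>" using star_subset_torsion_class[OF t] le by blast
  show "\<T> \<subseteq> star \<C> \<T>\<^sub>1 (\<T> \<inter> \<F>\<^sub>1)"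
  proof
    fix M assume "M \<in> \<T>"
    then show "M \<in> star \<C> \<T>\<^sub>1 (\<T> \<inter> \<F>\<^sub>1)"
      by (rule torsion_class_decompose[OF t le]) (rule starI)
  qed
qed

section \<open>Lifting s-torsion pairs from the heart\<close>

context
  fixes \<X> \<Y>
  assumes h: "(\<X>, \<Y>) \<in> s_torsion_pairs (restrict_to \<C> \<H>)"
begin

lemmas h_iff = h[unfolded s_torsion_pairs_restrict_iff[OF subcategory_heart]]

lemma orthogonal_lift:
  "orthogonal \<T>\<^sub>1 (star \<C> \<Y> \<F>\<^sub>2)" "orthogonal (star \<C> \<T>\<^sub>1 \<X>) \<Y>" "orthogonal \<X> (star \<C> \<Y> \<F>\<^sub>2)"
  "orthogonal (star \<C> \<T>\<^sub>1 \<X>) (star \<C> \<Y> \<F>\<^sub>2)"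
proof -
  note i = t1[unfolded s_torsion_pairs_iff] t2[unfolded s_torsion_pairs_iff] h_iff
  have sub: "\<T>\<^sub>1 \<subseteq> Ob \<C>" "\<X> \<subseteq> Ob \<C>" "\<Y> \<subseteq> Ob \<C>" using i by blast+
  have "\<X> \<subseteq> \<T>\<^sub>2" "\<Y> \<subseteq> \<F>\<^sub>1" using i by blast+
  \<comment> \<open>The four pairings of building blocks come from the pair on the heart and from
    the two bounding pairs; \<open>star\<close> then assembles them.\<close>
  then have o: "orthogonal \<T>\<^sub>1 \<Y>" "orthogonal \<T>\<^sub>1 \<F>\<^sub>2" "orthogonal \<X> \<Y>" "orthogonal \<X> \<F>\<^sub>2"
    using i orthogonal_mono T1_T2 by blast+
  show 1: "orthogonal \<T>\<^sub>1 (star \<C> \<Y> \<F>\<^sub>2)" "orthogonal \<X> (star \<C> \<Y> \<F>\<^sub>2)"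
    using orthogonal_star_right o sub by blast+
  show "orthogonal (star \<C> \<T>\<^sub>1 \<X>) \<Y>" using orthogonal_star_left o sub by blast
  show "orthogonal (star \<C> \<T>\<^sub>1 \<X>) (star \<C> \<Y> \<F>\<^sub>2)"
    by (rule orthogonal_star_left[OF 1]) (auto simp: star_def)
qed

lemma lift_s_torsion_pair: "(star \<C> \<T>\<^sub>1 \<X>, star \<C> \<Y> \<F>\<^sub>2) \<in> s_torsion_pairs \<C>"
  unfolding s_torsion_pairs_iff
proof (intro conjI subcategory_star orthogonal_lift)
  show "star \<C> \<T>\<^sub>1 \<X> \<subseteq> Ob \<C>" "star \<C> \<Y> \<F>\<^sub>2 \<subseteq> Ob \<C>" by (auto simp: star_def)
  show "Ob \<C> \<subseteq> star \<C> (star \<C> \<T>\<^sub>1 \<X>) (star \<C> \<Y> \<F>\<^sub>2)"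
  proof
    fix M assume "M \<in> Ob \<C>"
    then have "M \<in> star \<C> \<T>\<^sub>2 \<F>\<^sub>2" using t2 unfolding s_torsion_pairs_iff by blast
    then obtain B F x y \<delta> where c: "B \<in> \<T>\<^sub>2" "F \<in> \<F>\<^sub>2" "conflation \<C> B M F x y \<delta>" by (rule starE)
    obtain A N x' y' \<delta>' where c': "A \<in> \<T>\<^sub>1" "N \<in> \<H>" "conflation \<C> A B N x' y' \<delta>'"
      using torsion_class_decompose[OF t2 T1_T2 c(1)] .
    \<comment> \<open>The heart object \<open>N\<close> lies in \<open>\<X> * \<Y>\<close>, so
      \<open>B\<close> lies in \<open>\<T>\<^sub>1 * (\<X> * \<Y>)\<close> and is regrouped; the
      next line regroups once more with \<open>F\<close> on the right.\<close>
    have "B \<in> star \<C> (star \<C> \<T>\<^sub>1 \<X>) \<Y>" using star_op_assoc[OF c'(3)] c' h_iff by blast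
    then show "M \<in> star \<C> (star \<C> \<T>\<^sub>1 \<X>) (star \<C> \<Y> \<F>\<^sub>2)" using star_assoc[OF c(3)] c by blast
  qed
qed

text \<open>The first two inclusions follow from orthogonality to the lifted torsion-free class,
  which avoids trivial conflations with zero objects in \<open>\<T>\<^sub>1\<close> or
  \<open>\<X>\<close>. The third is extension-closure of \<open>\<T>\<^sub>2\<close>.\<close>

lemma lift_bounds: "\<T>\<^sub>1 \<subseteq> star \<C> \<T>\<^sub>1 \<X>" "\<X> \<subseteq> star \<C> \<T>\<^sub>1 \<X>" "star \<C> \<T>\<^sub>1 \<X> \<subseteq> \<T>\<^sub>2"
proof -
  note i = t1[unfolded s_torsion_pairs_iff] h_iff
  have "\<T>\<^sub>1 \<subseteq> Ob \<C>" "\<X> \<subseteq> Ob \<C>" using i by (auto simp: subcategory_def)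
  then show "\<T>\<^sub>1 \<subseteq> star \<C> \<T>\<^sub>1 \<X>" "\<X> \<subseteq> star \<C> \<T>\<^sub>1 \<X>"
    using torsion_class_memI'[OF lift_s_torsion_pair] orthogonal_lift(1,3)
    unfolding orthogonal_def by blast+
  show "star \<C> \<T>\<^sub>1 \<X> \<subseteq> \<T>\<^sub>2" using star_subset_torsion_class[OF t2 T1_T2] h_iff by blast
qed

text \<open>An object of the lifted class in \<open>\<F>\<^sub>1\<close> lies in the heart and has
  no nonzero morphisms to \<open>\<Y>\<close>, hence belongs to \<open>\<X>\<close>.\<close>

lemma restrict_lift: "star \<C> \<T>\<^sub>1 \<X> \<inter> \<F>\<^sub>1 = \<X>"
proof
  show "\<X> \<subseteq> star \<C> \<T>\<^sub>1 \<X> \<inter> \<F>\<^sub>1" using lift_bounds h_iff by blast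
  show "star \<C> \<T>\<^sub>1 \<X> \<inter> \<F>\<^sub>1 \<subseteq> \<X>"
    using torsion_class_memI[OF subcategory_heart h] lift_bounds(3) orthogonal_lift(2)
    unfolding orthogonal_def by blast
qed

end

section \<open>The poset isomorphism\<close>

lemma poset_iso_heart:
  "poset_iso (stp_interval \<C> (\<T>\<^sub>1, \<F>\<^sub>1) (\<T>\<^sub>2, \<F>\<^sub>2)) stp_le
     (s_torsion_pairs (restrict_to \<C> \<H>)) stp_le (\<lambda>(\<T>, \<F>). (\<T> \<inter> \<F>\<^sub>1, \<T>\<^sub>2 \<inter> \<F>))"
  (is "poset_iso ?I _ ?S _ ?\<phi>")
proof -
  have I: "(\<T>, \<F>) \<in> ?I \<longleftrightarrow> (\<T>, \<F>) \<in> s_torsion_pairs \<C> \<and> \<T>\<^sub>1 \<subseteq> \<T> \<and> \<T> \<subseteq> \<T>\<^sub>2" for \<T> \<F>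
    by (auto simp: stp_interval_def stp_le_def)
  have le: "stp_le p q \<longleftrightarrow> stp_le (?\<phi> p) (?\<phi> q)" if p: "p \<in> ?I" and q: "q \<in> ?I" for p q
  proof -
    obtain \<T> \<F> \<T>' \<F>' where e: "p = (\<T>, \<F>)" "q = (\<T>', \<F>')" by fastforce
    have "star \<C> \<T>\<^sub>1 (\<T> \<inter> \<F>\<^sub>1) = \<T>" "star \<C> \<T>\<^sub>1 (\<T>' \<inter> \<F>\<^sub>1) = \<T>'"
      using torsion_class_eq_star p q unfolding e I by blast+
    then have "\<T> \<inter> \<F>\<^sub>1 \<subseteq> \<T>' \<inter> \<F>\<^sub>1 \<Longrightarrow> \<T> \<subseteq> \<T>'" using star_mono[of \<T>\<^sub>1 \<T>\<^sub>1] by blast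
    then show ?thesis unfolding e stp_le_def by auto
  qed
  have "inj_on ?\<phi> ?I"
  proof (rule inj_onI)
    fix p q assume p: "p \<in> ?I" and q: "q \<in> ?I" and eq: "?\<phi> p = ?\<phi> q"
    \<comment> \<open>Equal images give both inequalities, so the torsion classes agree; the
      torsion-free classes then agree by antitonicity.\<close>
    then have "fst p = fst q" using le[OF p q] le[OF q p] unfolding stp_le_def by auto
    moreover obtain \<T> \<F> \<T>' \<F>' where e: "p = (\<T>, \<F>)" "q = (\<T>', \<F>')" by fastforce
    ultimately show "p = q"
      using p q antimono[of \<T> \<F> \<T>' \<F>'] antimono[of \<T>' \<F>' \<T> \<F>] unfolding e I by simp
  qed
  moreover have "?\<phi> ` ?I \<subseteq> ?S" using restrict_to_heart I by auto
  moreover have "?S \<subseteq> ?\<phi> ` ?I"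
  proof
    fix s assume s: "s \<in> ?S"
    obtain \<X> \<Y> where e: "s = (\<X>, \<Y>)" by fastforce
    note s = s[unfolded e]
    note l = lift_s_torsion_pair[OF s] lift_bounds(1,3)[OF s]
    \<comment> \<open>The lifted pair restricts to one with torsion class \<open>\<X>\<close>. Its
      torsion-free class needs no separate computation, being determined by
      \<open>\<X>\<close>.\<close>
    have "(\<X>, \<T>\<^sub>2 \<inter> star \<C> \<Y> \<F>\<^sub>2) \<in> ?S" using restrict_to_heart[OF l] restrict_lift[OF s] by simp
    then have "\<Y> = \<T>\<^sub>2 \<inter> star \<C> \<Y> \<F>\<^sub>2" using s_torsion_pair_eqI[OF subcategory_heart s] by blast
    then have "s = ?\<phi> (star \<C> \<T>\<^sub>1 \<X>, star \<C> \<Y> \<F>\<^sub>2)" using e restrict_lift[OF s] by simp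
    then show "s \<in> ?\<phi> ` ?I" using l I by blast
  qed
  ultimately show ?thesis using le unfolding poset_iso_def bij_betw_def by blast
qed

end

theorem theorem1p3:
  fixes \<C> :: "('o, 'm, 'e, 'n) pre_neg_extriangulated"
    and t\<^sub>1 t\<^sub>2 :: "'o set \<times> 'o set"
  assumes "neg_extriangulated_category \<C>"
    and "t\<^sub>1 \<in> s_torsion_pairs \<C>" and "t\<^sub>2 \<in> s_torsion_pairs \<C>"
    and "stp_le t\<^sub>1 t\<^sub>2"
  shows "\<exists>\<phi>. poset_iso (stp_interval \<C> t\<^sub>1 t\<^sub>2) stp_le
                     (s_torsion_pairs (restrict_to \<C> (heart t\<^sub>1 t\<^sub>2))) stp_le \<phi>"
proof -
  interpret s_torsion_interval \<C> "fst t\<^sub>1" "snd t\<^sub>1" "fst t\<^sub>2" "snd t\<^sub>2"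
    using assms by (simp add: s_torsion_interval_def s_torsion_interval_axioms_def stp_le_def)
  show ?thesis using poset_iso_heart unfolding heart_def by auto
qed

end
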